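(* Let $(X,\mathbb P_x)_{x\in D}$ be a stochastically continuous affine process on $D=\mathbb R_+^m\times\mathbb R^n$ with admissible parameters $(\alpha,\beta,\gamma,\kappa)$. The following are equivalent: (i) $(X,\mathbb P_x)_{x\in D}$ is conservative, i.e. $p_t(x,D)=1$ for all $t\ge0$, $x\in D$; (ii) $R_0(0)=0$ and there is no non-trivial $\mathbb R_-^m$-valued local solution $g$ (on some interval $[0,T)$, $T>0$) of $\partial_t g(t)=R_{\mathcal I}(g(t),0)$ with $g(0)=0$. Moreover, each of these statements implies $R(0)=0$ (equivalently, together with $R_0(0)=0$, $\gamma=0$).
   Context: Setting: $m,n\ge0$, $d=m+n\ge1$, $D=\mathbb R_+^m\times\mathbb R^n$. $(X,\mathbb P_x)_{x\in D}$ is a time-homogeneous Markov process with values in the one-point compactification $D_\Delta$ and transition function $p_t(x,d\xi)$. It is stochastically continuous if $p_s(x,\cdot)\to p_t(x,\cdot)$ weakly as $s\to t$ for all $(t,x)$, and affine if for all $t\ge0$, $u\in i\mathbb R^d$ there are $\psi_0(t,u)\in\mathbb C$, $\psi(t,u)\in\mathbb C^d$ with $\int_D e^{\langle u,\xi\rangle}p_t(x,d\xi)=\exp(\psi_0(t,u)+\langle\psi(t,u),x\rangle)$ for all $x\in D$. Truncation function $h=(h_1,\dots,h_d)$: $h_k(\xi)=0$ if $\xi_k=0$, else $(1\wedge|\xi_k|)\xi_k/|\xi_k|$. Parameters $(\alpha,\beta,\gamma,\kappa)$ are admissible if: $\alpha=(\alpha_0,\dots,\alpha_d)$ are symmetric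 positive semidefinite $d\times d$ matrices with $\alpha_j=0$ for $j\ge m+1$ and $\alpha_j^{kl}=0$ for $0\le j\le m$, $1\le k,l\le m$ unless $k=l=j$; $\kappa=(\kappa_0,\dots,\kappa_d)$ are Borel measures on $D\setminus\{0\}$ with $\kappa_j=0$ for $j\ge m+1$, $\int\|h(\xi)\|^2\kappa_j(d\xi)<\infty$ for $0\le j\le m$ and $\int|h_k(\xi)|\kappa_j(d\xi)<\infty$ for $0\le j\le m$, $1\le k\le m$, $k\ne j$; $\beta=(\beta_0,\dots,\beta_d)$, $\beta_j\in\mathbb R^d$, with $\beta_j^k=0$ for $j\ge m+1$, $1\le k\le m$, and $\beta_j^k-\int h_k(\xi)\kappa_j(d\xi)\ge0$ for $0\le j\le m$, $1\le k\le m$, $k\ne j$; $\gamma=(\gamma_0,\dots,\gamma_d)$ with $\gamma_j\ge0$ and $\gamma_j=0$ for $j\ge m+1$. For $0\le i\le d$, $$R_i(u)=\tfrac12\langle\alpha_iu,u\rangle+\langle\beta_i,u\rangle-\gamma_i+\int_{D\setminus\{0\}}\big(e^{\langle u,\xi\rangle}-1-\langle u,h(\xi)\rangle\big)\kappa_i(d\xi),$$ $R=(R_1,\dots,R_d)$. Every stochastically continuous affine process has unique admissible parameters such that $\partial_t\psi=R(\psi)$, $\psi(0,u)=u$, $\partial_t\psi_0=R_0(\psi)$, $\psi_0(0,u)=0$; conversely each admissible parameter set determines a unique stochastically continuous affine process. Notation: $\mathcal I=\{1,\dots,m\}$, $R_{\mathcal I}=(R_1,\dots,R_m)$, and $R_{\mathcal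 I}(v,0)$ means $R_{\mathcal I}$ evaluated at $(v_1,\dots,v_m,0,\dots,0)$, well defined for $v\in\mathbb R_-^m$. *)

theory Defs
  imports "HOL-Probability.Probability"
begin

text \<open>State space D = R_+^m x R^n.  Coordinates are indexed by a finite type 'd
  (so d = CARD('d) >= 1); the set I of 'd collects the m nonnegative coordinates,
  the remaining n = CARD('d) - card I coordinates are real.  Parameter indices
  0,1,...,d are encoded as 'd option, with None standing for the index 0.\<close>

definition stateD :: "'d::finite set \<Rightarrow> (real^'d) set" where
  "stateD I = {x. \<forall>i\<in>I. 0 \<le> x $ i}"

definition trunc_h :: "real^'d::finite \<Rightarrow> real^'d" where
  "trunc_h \<xi> = (\<chi> k. if \<xi> $ k = 0 then 0
                        else min 1 \<bar>\<xi> $ k\<bar> * (\<xi> $ k / \<bar>\<xi> $ k\<bar>))"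

text \<open>Transition function of a time-homogeneous Markov process on D with values in
  the one-point compactification: sub-probability kernels on D (missing mass = mass
  at the cemetery point), p_0(x,.) = delta_x, Chapman-Kolmogorov.\<close>
definition transition_function ::
  "'d::finite set \<Rightarrow> (real \<Rightarrow> real^'d \<Rightarrow> (real^'d) measure) \<Rightarrow> bool" where
  "transition_function I p \<longleftrightarrow>
     (\<forall>t\<ge>0. \<forall>x\<in>stateD I. sets (p t x) = sets borel \<and> subprob_space (p t x)
                \<and> emeasure (p t x) (UNIV - stateD I) = 0) \<and>
     (\<forall>t\<ge>0. \<forall>A\<in>sets borel.
         (\<lambda>x. emeasure (p t x) A) \<in> borel_measurable (restrict_space borel (stateD I))) \<and>
     (\<forall>x\<in>stateD I. p 0 x = return borel x) \<and>
     (\<forall>s\<ge>0. \<forall>t\<ge>0. \<forall>x\<in>stateD I. \<forall>A\<in>sets borel.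
         emeasure (p (s + t) x) A = (\<integral>\<^sup>+ y. emeasure (p t y) A \<partial>p s x))"

text \<open>Stochastic continuity: weak convergence on the one-point compactification D_Delta,
  i.e. convergence of integrals of all continuous functions on D_Delta; these are
  exactly constants plus continuous functions on D vanishing at infinity, and the
  total mass on D_Delta is 1, so it amounts to the following.\<close>
definition stoch_continuous ::
  "'d::finite set \<Rightarrow> (real \<Rightarrow> real^'d \<Rightarrow> (real^'d) measure) \<Rightarrow> bool" where
  "stoch_continuous I p \<longleftrightarrow>
     (\<forall>t\<ge>0. \<forall>x\<in>stateD I. \<forall>f :: real^'d \<Rightarrow> real.
        continuous_on (stateD I) f \<and>
        (\<forall>e>0. \<exists>r. \<forall>y\<in>stateD I. r \<le> norm y \<longrightarrow> \<bar>f y\<bar> < e) \<longrightarrow>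
        ((\<lambda>s. \<integral>y. f y \<partial>p s x) \<longlongrightarrow> (\<integral>y. f y \<partial>p t x)) (at t within {0..}))"

text \<open>Affine property with given functions psi0, psi; u = i v with v real.\<close>
definition affine_with ::
  "'d::finite set \<Rightarrow> (real \<Rightarrow> real^'d \<Rightarrow> (real^'d) measure)
     \<Rightarrow> (real \<Rightarrow> real^'d \<Rightarrow> complex) \<Rightarrow> (real \<Rightarrow> real^'d \<Rightarrow> complex^'d) \<Rightarrow> bool" where
  "affine_with I p psi0 psi \<longleftrightarrow>
     (\<forall>t\<ge>0. \<forall>v. \<forall>x\<in>stateD I.
        (\<integral>\<xi>. exp (\<Sum>k\<in>UNIV. (\<i> * of_real (v $ k)) * of_real (\<xi> $ k)) \<partial>p t x)
          = exp (psi0 t v + (\<Sum>k\<in>UNIV. psi t v $ k * of_real (x $ k))))"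

definition admissible ::
  "'d::finite set \<Rightarrow> ('d option \<Rightarrow> real^'d^'d) \<Rightarrow> ('d option \<Rightarrow> real^'d)
     \<Rightarrow> ('d option \<Rightarrow> real) \<Rightarrow> ('d option \<Rightarrow> (real^'d) measure) \<Rightarrow> bool" where
  "admissible I alpha beta gamma kappa \<longleftrightarrow>
     \<comment> \<open>alpha\<close>
     (\<forall>j. transpose (alpha j) = alpha j \<and> (\<forall>y. 0 \<le> y \<bullet> (alpha j *v y))) \<and>
     (\<forall>i. i \<notin> I \<longrightarrow> alpha (Some i) = 0) \<and>
     (\<forall>j. (j = None \<or> (\<exists>i\<in>I. j = Some i)) \<longrightarrow>
        (\<forall>k\<in>I. \<forall>l\<in>I. \<not> (j = Some k \<and> j = Some l) \<longrightarrow> alpha j $ k $ l = 0)) \<and>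
     \<comment> \<open>kappa: Borel measures on D minus the origin\<close>
     (\<forall>j. sets (kappa j) = sets borel \<and>
          emeasure (kappa j) (UNIV - (stateD I - {0})) = 0) \<and>
     (\<forall>i. i \<notin> I \<longrightarrow> (\<forall>A. emeasure (kappa (Some i)) A = 0)) \<and>
     (\<forall>j. (j = None \<or> (\<exists>i\<in>I. j = Some i)) \<longrightarrow>
        (\<integral>\<^sup>+ \<xi>. ennreal ((norm (trunc_h \<xi>))\<^sup>2) \<partial>kappa j) < \<infinity> \<and>
        (\<forall>k\<in>I. j \<noteq> Some k \<longrightarrow> (\<integral>\<^sup>+ \<xi>. ennreal \<bar>trunc_h \<xi> $ k\<bar> \<partial>kappa j) < \<infinity>)) \<and>
     \<comment> \<open>beta\<close>
     (\<forall>i k. i \<notin> I \<longrightarrow> k \<in> I \<longrightarrow> beta (Some i) $ k = 0) \<and>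
     (\<forall>j. (j = None \<or> (\<exists>i\<in>I. j = Some i)) \<longrightarrow>
        (\<forall>k\<in>I. j \<noteq> Some k \<longrightarrow> 0 \<le> beta j $ k - (\<integral>\<xi>. trunc_h \<xi> $ k \<partial>kappa j))) \<and>
     \<comment> \<open>gamma\<close>
     (\<forall>j. 0 \<le> gamma j) \<and> (\<forall>i. i \<notin> I \<longrightarrow> gamma (Some i) = 0)"

definition Rfun ::
  "('d::finite option \<Rightarrow> real^'d^'d) \<Rightarrow> ('d option \<Rightarrow> real^'d)
     \<Rightarrow> ('d option \<Rightarrow> real) \<Rightarrow> ('d option \<Rightarrow> (real^'d) measure)
     \<Rightarrow> 'd option \<Rightarrow> complex^'d \<Rightarrow> complex" where
  "Rfun alpha beta gamma kappa i u =
     (1/2) * (\<Sum>k\<in>UNIV. \<Sum>l\<in>UNIV. of_real (alpha i $ k $ l) * u $ l * u $ k)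
     + (\<Sum>k\<in>UNIV. of_real (beta i $ k) * u $ k)
     - of_real (gamma i)
     + (\<integral>\<xi>. exp (\<Sum>k\<in>UNIV. u $ k * of_real (\<xi> $ k)) - 1
              - (\<Sum>k\<in>UNIV. u $ k * of_real (trunc_h \<xi> $ k)) \<partial>kappa i)"

end

theory Submission
  imports Defs "HOL-Complex_Analysis.Cauchy_Integral_Formula" "HOL-Real_Asymp.Real_Asymp"
begin

text \<open>
  The total mass of the transition kernel is the value at zero of its Fourier transform, so
  conservativeness says that the Riccati flow started at zero vanishes. Since that flow is real and
  lies in the negative cone, uniqueness for the real Riccati equation gives conservativeness at once.

  For the converse, the information on the imaginary axis is moved to real arguments by the
  representation of exp (- s), for s nonnegative, as an integral of exp (i w s) against a kernel that
  decays like the inverse fourth power of w. It shows that the Laplace transform of the process is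
  exponentially affine in the starting point and has at time zero the right derivative predicted by
  R. If g solves the real Riccati equation from zero, convexity of R turns
  (1 - e) g(t) - e exp (- C t) into a strict supersolution. Continuous induction in t, using
  Chapman-Kolmogorov, then bounds the Laplace transform of the process by this supersolution; as e
  tends to zero the Laplace transform tends to the total mass one, which forces g to vanish.
\<close>

section \<open>A Laplace kernel on the imaginary axis\<close>

text \<open>The affine property is given on the imaginary axis only, and R need not be Lipschitz at
  the boundary of the negative cone; that is how a non-trivial solution from zero can arise at all.
  Neither an analytic extension of \<open>psi\<close> nor a uniqueness theorem is therefore at hand,
  and the real Riccati flow of the process is never constructed. For each fixed time the Laplace
  transform is only known to be exponentially affine; its continuity in time and its right
  derivative at time zero are all that the induction consumes. The decay of the kernel is dictated
  by R: since R grows quadratically, difference quotients of the characteristic function in time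
  have size 1 + w^2, and four is the smallest integer exponent for which this is absolutely
  integrable against the kernel. Exponential affineness also makes the comparison uniform over the
  unbounded state space, because one short time step reduces to finitely many inequalities between
  coefficients. Their strictness takes the place of a Lipschitz condition.\<close>

definition half_disc_path :: "real \<Rightarrow> real \<Rightarrow> complex" where
  "half_disc_path R =
     linepath (- \<i> * of_real R) (\<i> * of_real R) +++ part_circlepath 0 R (pi/2) (3*pi/2)"

lemma norm_one_minus_ge_one: "Re z \<le> 0 \<Longrightarrow> 1 \<le> norm (1 - z)"
  using complex_Re_le_cmod[of "1 - z"] by simp

text \<open>Cauchy's formula at the simple pole -1 leaves only the arc. Its length is pi R, and the
  integrand on it is at most 1 / (R - 1)^2, one factor coming from the bound on F and one from the
  pole. The winding number stays symbolic here.\<close>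

lemma half_disc_path_Cauchy:
  assumes hol: "F holomorphic_on {z. Re z < 1}"
    and bnd: "\<And>z. Re z \<le> 0 \<Longrightarrow> norm (F z) \<le> 1 / norm (1 - z)"
    and R: "1 < R"
  shows "norm (contour_integral (linepath (- \<i> * of_real R) (\<i> * of_real R)) (\<lambda>z. F z / (z + 1))
            - 2 * pi * \<i> * winding_number (half_disc_path R) (-1) * F (-1)) \<le> pi * R / (R - 1)\<^sup>2"
proof -
  let ?l = "linepath (- \<i> * of_real R) (\<i> * of_real R)"
  let ?c = "part_circlepath 0 R (pi/2) (3*pi/2)"
  let ?f = "\<lambda>z. F z / (z + 1)"
  have fin: "pathfinish ?l = pathstart ?c"
    by simp (metis cis_conv_exp cis_pi_half mult.commute of_real_divide of_real_numeral times_divide_eq_right)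
  have sin3: "sin (3 * pi / 2) = -1" "cos (3 * pi / 2) = 0"
  proof -
    have "3 * pi / 2 = pi / 2 + pi" by simp
    then show "sin (3 * pi / 2) = -1" "cos (3 * pi / 2) = 0"
      by (simp_all only: sin_periodic_pi cos_periodic_pi sin_pi_half cos_pi_half)
  qed
  have st: "pathfinish ?c = pathstart ?l"
  proof -
    have "exp (\<i> * of_real (3 * pi / 2)) = - \<i>"
      using sin3 by (simp only: cis_conv_exp[symmetric] complex_eq_iff cis.sel) simp
    then show ?thesis by simp
  qed
  have imc: "Re z \<le> 0 \<and> norm z = R" if z: "z \<in> path_image ?c" for z
  proof -
    obtain x where x: "pi/2 \<le> x" "x \<le> 3*pi/2" "z = 0 + of_real R * exp (\<i> * of_real x)"
      using z path_image_part_circlepath[of "pi/2" "3*pi/2" 0 R] by auto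
    have "0 \<le> cos (x - pi)"
      by (rule cos_ge_zero) (use x in auto)
    then have "cos x \<le> 0" by (simp add: cos_diff)
    then show ?thesis using x R
      by (auto simp: norm_mult Re_exp mult_nonneg_nonpos)
  qed
  have iml: "Re z = 0" if "z \<in> path_image ?l" for z
    using that by (auto simp: in_segment)
  have vl: "valid_path (half_disc_path R)"
    unfolding half_disc_path_def using fin by (intro valid_path_join) auto
  have im: "path_image (half_disc_path R) \<subseteq> {z. Re z < 1} - {-1}"
  proof -
    have "z \<in> {z. Re z < 1} - {-1}" if "z \<in> path_image ?l \<union> path_image ?c" for z
    proof -
      consider "z \<in> path_image ?l" | "z \<in> path_image ?c" using \<open>z \<in> path_image ?l \<union> path_image ?c\<close> by blast
      then show ?thesis
      proof cases
        case 1 then show ?thesis using iml[OF 1] by auto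
      next
        case 2 then show ?thesis using imc[OF 2] R by auto
      qed
    qed
    then show ?thesis
      unfolding half_disc_path_def using fin by (auto simp only: path_image_join)
  qed
  have op: "open {z. Re z < 1}" by (simp add: open_halfspace_Re_lt)
  have "((\<lambda>w. F w / (w - (-1))) has_contour_integral
      (2*pi * \<i> * winding_number (half_disc_path R) (-1) * F (-1))) (half_disc_path R)"
  proof (rule Cauchy_integral_formula_convex_simple)
    show "convex {z. Re z < 1}" by (simp add: convex_halfspace_Re_lt)
    show "-1 \<in> interior {z. Re z < 1}" using op by (simp add: interior_open)
    show "pathfinish (half_disc_path R) = pathstart (half_disc_path R)"
      using st by (simp add: half_disc_path_def)
  qed (use hol vl im in auto)
  then have main: "(?f has_contour_integral
      (2*pi * \<i> * winding_number (half_disc_path R) (-1) * F (-1))) (half_disc_path R)"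
    by simp
  have ij: "?f contour_integrable_on (?l +++ ?c)"
    using main unfolding half_disc_path_def contour_integrable_on_def by blast
  have il: "?f contour_integrable_on ?l"
    by (rule contour_integrable_joinD1[OF ij]) simp
  have ic: "?f contour_integrable_on ?c"
    by (rule contour_integrable_joinD2[OF ij]) simp
  have eq: "contour_integral (half_disc_path R) ?f = contour_integral ?l ?f + contour_integral ?c ?f"
    unfolding half_disc_path_def using il ic fin by (intro contour_integral_join) auto
  have "norm (contour_integral ?c ?f) \<le> (1 / (R-1)\<^sup>2) * R * \<bar>3*pi/2 - pi/2\<bar>"
  proof (rule contour_integral_bound_part_circlepath[OF ic])
    fix z assume "z \<in> path_image ?c"
    then have z: "Re z \<le> 0" "norm z = R" using imc by auto
    have a: "R - 1 \<le> norm (z + 1)" using norm_triangle_ineq2[of z "-1"] z by simp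
    have b: "R - 1 \<le> norm (1 - z)" using norm_triangle_ineq2[of z "1"] z by (simp add: norm_minus_commute)
    have "norm (?f z) \<le> (1 / norm (1 - z)) / norm (z + 1)"
      unfolding norm_divide using bnd[OF z(1)] by (intro divide_right_mono) auto
    also have "\<dots> \<le> (1 / (R - 1)) / (R - 1)"
      using a b R by (intro frac_le divide_nonneg_nonneg) auto
    finally show "norm (?f z) \<le> 1 / (R-1)\<^sup>2" by (simp add: power2_eq_square)
  qed (use R in auto)
  also have "\<dots> = pi * R / (R - 1)\<^sup>2" by simp
  finally have "norm (contour_integral ?c ?f) \<le> pi * R / (R - 1)\<^sup>2" .
  moreover have "contour_integral ?l ?f - 2 * pi * \<i> * winding_number (half_disc_path R) (-1) * F (-1)
     = - contour_integral ?c ?f"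
    using eq contour_integral_unique[OF main] by simp
  ultimately show ?thesis by (simp only: norm_minus_cancel)
qed

lemma lborel_inverse_1_plus_square:
  "integrable lborel (\<lambda>x::real. 1 / (1 + x\<^sup>2))" "(\<integral>x. 1 / (1 + x\<^sup>2) \<partial>lborel) = pi"
  using integrable_inverse_1_plus_square LBINT_inverse_1_plus_square
  by (simp_all add: set_integrable_def interval_lebesgue_integral_def set_lebesgue_integral_def
      inverse_eq_divide einterval_def)

text \<open>On the imaginary axis the integrand is dominated by 1 / (1 + w^2), so the truncated
  integrals converge while the arc contributes nothing in the limit.\<close>

lemma half_plane_line_integral_tendsto:
  fixes F :: "complex \<Rightarrow> complex"
  assumes hol: "F holomorphic_on {z. Re z < 1}"
    and bnd: "\<And>z. Re z \<le> 0 \<Longrightarrow> norm (F z) \<le> 1 / norm (1 - z)"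
  shows "((\<lambda>R. winding_number (half_disc_path R) (-1) * (2 * pi * F (-1)))
       \<longlongrightarrow> (\<integral>w. F (\<i> * of_real w) / (1 + \<i> * of_real w) \<partial>lborel)) at_top"
proof -
  let ?g = "\<lambda>w. F (\<i> * of_real w) / (1 + \<i> * of_real w)"
  have contF: "continuous_on {z. Re z < 1} F"
    using hol by (rule holomorphic_on_imp_continuous_on)
  have cont: "continuous_on UNIV ?g"
    by (intro continuous_intros continuous_on_compose2[OF contF])
       (auto simp: complex_eq_iff)
  then have meas [measurable]: "?g \<in> borel_measurable borel"
    by (rule borel_measurable_continuous_onI)
  have nrm: "norm (?g w) \<le> 1 / (1 + w\<^sup>2)" for w
  proof -
    have "norm (?g w) \<le> (1 / norm (1 - \<i> * of_real w)) / norm (1 + \<i> * of_real w)"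
      unfolding norm_divide using bnd[of "\<i> * of_real w"] by (intro divide_right_mono) auto
    also have "\<dots> = 1 / (1 + w\<^sup>2)"
      by (simp add: cmod_def power2_eq_square flip: real_sqrt_mult)
    finally show ?thesis .
  qed
  have int: "integrable lborel ?g"
    by (rule Bochner_Integration.integrable_bound[OF lborel_inverse_1_plus_square(1)])
       (use nrm in \<open>auto simp: abs_of_pos add_pos_nonneg\<close>)
  have lim1: "((\<lambda>R. \<integral>w. indicator {-R..R} w *\<^sub>R ?g w \<partial>lborel) \<longlongrightarrow> (\<integral>w. ?g w \<partial>lborel)) at_top"
  proof (rule integral_dominated_convergence_at_top[where w="\<lambda>w. 1 / (1 + w\<^sup>2)"])
    show "\<forall>\<^sub>F R in at_top. AE w in lborel. norm (indicator {-R..R} w *\<^sub>R ?g w) \<le> 1 / (1 + w\<^sup>2)"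
      using nrm by (intro always_eventually allI AE_I2) (auto simp: indicator_def add_nonneg_nonneg)
    have "((\<lambda>R. indicator {-R..R} w *\<^sub>R ?g w) \<longlongrightarrow> ?g w) at_top" for w
    proof (rule tendsto_eventually)
      show "\<forall>\<^sub>F R in at_top. indicator {-R..R} w *\<^sub>R ?g w = ?g w"
        using eventually_ge_at_top[of "\<bar>w\<bar>"] by eventually_elim (auto simp: indicator_def)
    qed
    then show "AE w in lborel. ((\<lambda>R. indicator {-R..R} w *\<^sub>R ?g w) \<longlongrightarrow> ?g w) at_top"
      by simp
  qed (use lborel_inverse_1_plus_square(1) in auto)
  have ci: "contour_integral (linepath (- \<i> * of_real R) (\<i> * of_real R)) (\<lambda>z. F z / (z + 1))
        = \<i> * (\<integral>w. indicator {-R..R} w *\<^sub>R ?g w \<partial>lborel)" if "R > 1" for R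
  proof -
    have "contour_integral (linepath (- \<i> * of_real R) (\<i> * of_real R)) (\<lambda>z. F z / (z + 1))
       = \<i> * integral {-R..R} (\<lambda>x. F (Complex 0 x) / (Complex 0 x + 1))"
      using that by (intro contour_integral_linepath_same_Re) auto
    also have "integral {-R..R} (\<lambda>x. F (Complex 0 x) / (Complex 0 x + 1)) = integral {-R..R} ?g"
      by (simp add: Complex_eq add.commute)
    also have "\<dots> = (LINT w:{-R..R}|lborel. ?g w)"
    proof (rule set_borel_integral_eq_integral(2)[symmetric])
      show "set_integrable lborel {-R..R} ?g"
        unfolding set_integrable_def by (intro integrable_mult_indicator int) auto
    qed
    finally show ?thesis by (simp add: set_lebesgue_integral_def)
  qed
  have lim2: "((\<lambda>R. contour_integral (linepath (- \<i> * of_real R) (\<i> * of_real R)) (\<lambda>z. F z / (z + 1))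
            - 2 * pi * \<i> * winding_number (half_disc_path R) (-1) * F (-1)) \<longlongrightarrow> 0) at_top"
  proof (rule Lim_null_comparison)
    show "\<forall>\<^sub>F R in at_top. norm (contour_integral (linepath (- \<i> * of_real R) (\<i> * of_real R)) (\<lambda>z. F z / (z + 1))
            - 2 * pi * \<i> * winding_number (half_disc_path R) (-1) * F (-1)) \<le> pi * R / (R - 1)\<^sup>2"
      using eventually_gt_at_top[of 1] by eventually_elim (rule half_disc_path_Cauchy[OF hol bnd])
    show "((\<lambda>R. pi * R / (R - 1)\<^sup>2) \<longlongrightarrow> 0) at_top" by real_asymp
  qed
  \<comment> \<open>With dz = i dw the contour integral is i times the truncated line integral.
    Multiplying the vanishing remainder by i therefore cancels the line integral and leaves the
    winding number term.\<close>
  have "((\<lambda>R. (\<integral>w. indicator {-R..R} w *\<^sub>R ?g w \<partial>lborel) + \<i> * (contour_integral (linepath (- \<i> * of_real R) (\<i> * of_real R)) (\<lambda>z. F z / (z + 1))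
            - 2 * pi * \<i> * winding_number (half_disc_path R) (-1) * F (-1))) \<longlongrightarrow> (\<integral>w. ?g w \<partial>lborel) + \<i> * 0) at_top"
    by (intro tendsto_intros lim1 lim2)
  then show "((\<lambda>R. winding_number (half_disc_path R) (-1) * (2 * pi * F (-1))) \<longlongrightarrow> (\<integral>w. ?g w \<partial>lborel)) at_top"
    unfolding mult_zero_right add_0_right
  proof (rule Lim_transform_eventually)
    show "\<forall>\<^sub>F R in at_top. (\<integral>w. indicator {-R..R} w *\<^sub>R ?g w \<partial>lborel) + \<i> * (contour_integral (linepath (- \<i> * of_real R) (\<i> * of_real R)) (\<lambda>z. F z / (z + 1))
            - 2 * pi * \<i> * winding_number (half_disc_path R) (-1) * F (-1))
       = winding_number (half_disc_path R) (-1) * (2 * pi * F (-1))"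
      using eventually_gt_at_top[of 1]
      by eventually_elim (simp only: ci, simp add: algebra_simps)
  qed
qed

text \<open>The winding number is read off from a known integral instead of the path: F z = 1 / (1 -
  z) turns the line integral into that of 1 / (1 + w^2), which is pi, and 2 pi F (-1) is pi as well.
  Only large radii are used, so the limit is enough.\<close>

lemma half_disc_path_winding_number_tendsto:
  "((\<lambda>R. winding_number (half_disc_path R) (-1)) \<longlongrightarrow> 1) at_top"
proof -
  let ?F = "\<lambda>z::complex. 1 / (1 - z)"
  have "((\<lambda>R. winding_number (half_disc_path R) (-1) * (2 * pi * ?F (-1)))
       \<longlongrightarrow> (\<integral>w. ?F (\<i> * of_real w) / (1 + \<i> * of_real w) \<partial>lborel)) at_top"
    by (rule half_plane_line_integral_tendsto)
       (auto intro!: holomorphic_intros simp: norm_divide)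
  also have "(\<lambda>w. ?F (\<i> * of_real w) / (1 + \<i> * of_real w)) = (\<lambda>w. complex_of_real (1 / (1 + w\<^sup>2)))"
    by (rule ext) (simp add: algebra_simps power2_eq_square)
  also have "(\<integral>w. complex_of_real (1 / (1 + w\<^sup>2)) \<partial>lborel) = pi"
    by (simp only: integral_complex_of_real lborel_inverse_1_plus_square)
  finally have "((\<lambda>R. winding_number (half_disc_path R) (-1) * (2 * pi * ?F (-1)) / pi) \<longlongrightarrow> pi / complex_of_real pi) at_top"
    by (intro tendsto_intros) auto
  then show ?thesis by simp
qed

lemma half_plane_line_integral:
  fixes F :: "complex \<Rightarrow> complex"
  assumes "F holomorphic_on {z. Re z < 1}"
    and "\<And>z. Re z \<le> 0 \<Longrightarrow> norm (F z) \<le> 1 / norm (1 - z)"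
  shows "(\<integral>w. F (\<i> * of_real w) / (1 + \<i> * of_real w) \<partial>lborel) = 2 * pi * F (-1)"
proof -
  have "((\<lambda>R. winding_number (half_disc_path R) (-1) * (2 * pi * F (-1))) \<longlongrightarrow> 1 * (2 * pi * F (-1))) at_top"
    by (intro tendsto_intros half_disc_path_winding_number_tendsto)
  from tendsto_unique[OF _ half_plane_line_integral_tendsto[OF assms] this] show ?thesis by simp
qed

section \<open>The kernel, its moments and its Fubini theorem\<close>

text \<open>The factor 1 + i w supplies the pole at -1 where Cauchy's formula evaluates. The three
  factors 1 - i w supply decay, two of them to absorb the quadratic part of R. At z = -1 they give
  8, and 4 / pi makes 2 pi / 8 equal to one.\<close>

definition laplace_kernel :: "real \<Rightarrow> complex" where
  "laplace_kernel w = (4 / pi) / ((1 + \<i> * of_real w) * (1 - \<i> * of_real w) ^ 3)"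

text \<open>Integration against the kernel evaluates at z = -1 a function known on the imaginary
  axis z = i w. The exponents n up to 2 serve the constant, linear and quadratic terms of R, and
  \<open>0 \<le> s\<close> keeps exp (z s) bounded in the left half plane.\<close>

lemma laplace_kernel_integral:
  assumes s: "0 \<le> s" and n: "n \<le> 2"
  shows "(\<integral>w. (\<i> * of_real w) ^ n * exp (\<i> * of_real (w * s)) * laplace_kernel w \<partial>lborel)
           = (-1) ^ n * exp (- s)"
proof -
  let ?F = "\<lambda>z::complex. z ^ n * exp (z * s) / (1 - z) ^ 3"
  have bnd: "norm (?F z) \<le> 1 / norm (1 - z)" if z: "Re z \<le> 0" for z
  proof -
    have a: "norm z \<le> norm (1 - z)" using z
      by (auto simp: cmod_def intro!: real_sqrt_le_mono power_mono_even)
    have b: "1 \<le> norm (1 - z)" by (rule norm_one_minus_ge_one[OF z])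
    have "norm z ^ n \<le> norm (1 - z) ^ n" by (intro power_mono a) auto
    also have "\<dots> \<le> norm (1 - z) ^ 2" by (intro power_increasing n b)
    finally have "norm z ^ n \<le> norm (1 - z) ^ 2" .
    moreover have "norm (exp (z * s)) \<le> 1" using z s by (simp add: mult_nonpos_nonneg)
    ultimately have "norm z ^ n * norm (exp (z * s)) \<le> norm (1 - z) ^ 2 * 1"
      by (intro mult_mono) auto
    then have "norm (?F z) \<le> norm (1 - z) ^ 2 / norm (1 - z) ^ 3"
      by (simp add: norm_mult norm_divide norm_power divide_right_mono)
    also have "\<dots> = 1 / norm (1 - z)" using b by (simp add: power2_eq_square power3_eq_cube)
    finally show ?thesis .
  qed
  have "(\<integral>w. ?F (\<i> * of_real w) / (1 + \<i> * of_real w) \<partial>lborel) = 2 * pi * ?F (-1)"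
    by (rule half_plane_line_integral) (use bnd in \<open>auto intro!: holomorphic_intros\<close>)
  then have "(\<integral>w. (4 / pi) * (?F (\<i> * of_real w) / (1 + \<i> * of_real w)) \<partial>lborel) = (4 / pi) * (2 * pi * ?F (-1))"
    by (simp only: integral_mult_right_zero)
  moreover have "(\<lambda>w. (4 / pi) * (?F (\<i> * of_real w) / (1 + \<i> * of_real w)))
     = (\<lambda>w. (\<i> * of_real w) ^ n * exp (\<i> * of_real (w * s)) * laplace_kernel w)"
    by (rule ext) (simp add: laplace_kernel_def mult_ac)
  moreover have "(4 / pi) * (2 * pi * ?F (-1)) = (-1) ^ n * exp (- s)"
    by (simp flip: exp_of_real)
  ultimately show ?thesis by simp
qed

lemma norm_laplace_kernel: "norm (laplace_kernel w) = (4 / pi) / (1 + w\<^sup>2)\<^sup>2"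
proof -
  have "norm (1 + \<i> * of_real w) = sqrt (1 + w\<^sup>2)" "norm (1 - \<i> * of_real w) = sqrt (1 + w\<^sup>2)"
    by (simp_all add: cmod_def)
  moreover have "sqrt (1 + w\<^sup>2) ^ 4 = (1 + w\<^sup>2)\<^sup>2"
    by (simp add: power4_eq_xxxx power2_eq_square flip: real_sqrt_mult)
  ultimately show ?thesis
    by (simp add: laplace_kernel_def norm_divide norm_mult norm_power flip: power_Suc numeral_eq_Suc)
qed

lemma laplace_kernel_measurable [measurable]: "laplace_kernel \<in> borel_measurable borel"
  unfolding laplace_kernel_def by measurable

lemma integrable_laplace_kernel_bound:
  "integrable lborel (\<lambda>w. (1 + w\<^sup>2) * norm (laplace_kernel w))"
proof -
  have "integrable lborel (\<lambda>w::real. (4 / pi) * (1 / (1 + w\<^sup>2)))"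
    by (intro integrable_mult_right lborel_inverse_1_plus_square)
  moreover have "(\<lambda>w::real. (4 / pi) * (1 / (1 + w\<^sup>2))) = (\<lambda>w. (1 + w\<^sup>2) * norm (laplace_kernel w))"
  proof
    fix w :: real
    have "(4 / pi) * (1 / p) = p * ((4 / pi) / p\<^sup>2)" if "p > 0" for p :: real
      using that by (simp add: power2_eq_square)
    from this[of "1 + w\<^sup>2"] show "(4 / pi) * (1 / (1 + w\<^sup>2)) = (1 + w\<^sup>2) * norm (laplace_kernel w)"
      unfolding norm_laplace_kernel by (simp add: add_pos_nonneg)
  qed
  ultimately show ?thesis by simp
qed

lemma integrable_times_laplace_kernel:
  fixes f :: "real \<Rightarrow> complex"
  assumes [measurable]: "f \<in> borel_measurable borel" and "\<And>w. norm (f w) \<le> C * (1 + w\<^sup>2)"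
  shows "integrable lborel (\<lambda>w. f w * laplace_kernel w)"
proof (rule Bochner_Integration.integrable_bound)
  show "integrable lborel (\<lambda>w. C * ((1 + w\<^sup>2) * norm (laplace_kernel w)))"
    by (intro integrable_mult_right integrable_laplace_kernel_bound)
  show "AE w in lborel. norm (f w * laplace_kernel w) \<le> norm (C * ((1 + w\<^sup>2) * norm (laplace_kernel w)))"
  proof (rule AE_I2)
    fix w
    have "norm (f w * laplace_kernel w) \<le> C * (1 + w\<^sup>2) * norm (laplace_kernel w)"
      by (simp add: norm_mult assms(2) mult_right_mono)
    then show "norm (f w * laplace_kernel w) \<le> norm (C * ((1 + w\<^sup>2) * norm (laplace_kernel w)))"
      by (simp add: mult.assoc)
  qed
qed auto

text \<open>The kernel absorbs quadratic growth in w, and finiteness of M does the rest. Later M is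
  a transition measure, a product of two of them, or a weighted Levy measure.\<close>

lemma laplace_kernel_Fubini:
  fixes f :: "'a \<Rightarrow> real \<Rightarrow> complex"
  assumes "finite_measure M" and [measurable]: "case_prod f \<in> borel_measurable (M \<Otimes>\<^sub>M borel)"
    and bnd: "\<And>\<xi> w. norm (f \<xi> w) \<le> C * (1 + w\<^sup>2)"
  shows "integrable lborel (\<lambda>w. (\<integral>\<xi>. f \<xi> w \<partial>M) * laplace_kernel w)"
    and "(\<integral>w. (\<integral>\<xi>. f \<xi> w \<partial>M) * laplace_kernel w \<partial>lborel) = (\<integral>\<xi>. (\<integral>w. f \<xi> w * laplace_kernel w \<partial>lborel) \<partial>M)"
proof -
  interpret finite_measure M by fact
  interpret pair_sigma_finite M lborel ..
  let ?f = "\<lambda>\<xi> w. f \<xi> w * laplace_kernel w"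
  have int: "integrable (M \<Otimes>\<^sub>M lborel) (case_prod ?f)"
  proof (rule Fubini_integrable)
    show "integrable M (\<lambda>x. \<integral>y. norm (case_prod ?f (x, y)) \<partial>lborel)"
    proof (rule integrable_const_bound)
      show "AE x in M. norm (\<integral>y. norm (case_prod ?f (x, y)) \<partial>lborel)
         \<le> (\<integral>w. C * ((1 + w\<^sup>2) * norm (laplace_kernel w)) \<partial>lborel)"
      proof (rule AE_I2)
        fix x assume "x \<in> space M"
        then have "integrable lborel (?f x)"
          by (intro integrable_times_laplace_kernel[where C=C] bnd) measurable
        then have "(\<integral>y. norm (?f x y) \<partial>lborel) \<le> (\<integral>w. C * ((1 + w\<^sup>2) * norm (laplace_kernel w)) \<partial>lborel)"
          by (intro integral_mono integrable_norm integrable_mult_right integrable_laplace_kernel_bound)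
             (auto simp: norm_mult mult.assoc[symmetric] intro!: mult_right_mono bnd)
        then show "norm (\<integral>y. norm (case_prod ?f (x, y)) \<partial>lborel)
         \<le> (\<integral>w. C * ((1 + w\<^sup>2) * norm (laplace_kernel w)) \<partial>lborel)" by simp
      qed
    qed measurable
    show "AE x in M. integrable lborel (\<lambda>y. case_prod ?f (x, y))"
      using bnd by (intro AE_I2) (auto intro!: integrable_times_laplace_kernel[where C=C])
  qed measurable
  show "integrable lborel (\<lambda>w. (\<integral>\<xi>. f \<xi> w \<partial>M) * laplace_kernel w)"
    using integrable_snd[OF int] by simp
  show "(\<integral>w. (\<integral>\<xi>. f \<xi> w \<partial>M) * laplace_kernel w \<partial>lborel) = (\<integral>\<xi>. (\<integral>w. f \<xi> w * laplace_kernel w \<partial>lborel) \<partial>M)"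
    using Fubini_integral[OF int] by simp
qed

lemma laplace_by_characteristic:
  assumes M: "finite_measure M" and [measurable]: "Y \<in> borel_measurable M" and pos: "AE \<xi> in M. 0 \<le> Y \<xi>"
  shows "complex_of_real (\<integral>\<xi>. exp (- Y \<xi>) \<partial>M)
     = (\<integral>w. (\<integral>\<xi>. exp (\<i> * of_real (w * Y \<xi>)) \<partial>M) * laplace_kernel w \<partial>lborel)"
proof -
  interpret finite_measure M by fact
  have "(\<integral>w. (\<integral>\<xi>. exp (\<i> * of_real (w * Y \<xi>)) \<partial>M) * laplace_kernel w \<partial>lborel)
      = (\<integral>\<xi>. (\<integral>w. exp (\<i> * of_real (w * Y \<xi>)) * laplace_kernel w \<partial>lborel) \<partial>M)"
    by (rule laplace_kernel_Fubini(2)[OF M, where C=1]) auto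
  also have "\<dots> = (\<integral>\<xi>. complex_of_real (exp (- Y \<xi>)) \<partial>M)"
  proof (rule integral_cong_AE)
    show "AE \<xi> in M. (\<integral>w. exp (\<i> * of_real (w * Y \<xi>)) * laplace_kernel w \<partial>lborel) = complex_of_real (exp (- Y \<xi>))"
      using pos by eventually_elim (use laplace_kernel_integral[of _ 0] in simp)
  qed measurable
  finally show ?thesis by (simp only: integral_complex_of_real)
qed

section \<open>The functions R on the left half space\<close>

text \<open>Two mean value estimates: exp has norm at most 1 on the left half plane, so exp w - 1 is
  at most norm w there; this in turn bounds the derivative of exp w - w along the segment from 0 to
  z.\<close>

lemma norm_exp_minus_one_minus_self_le:
  fixes z :: complex
  assumes z: "Re z \<le> 0"
  shows "norm (exp z - 1 - z) \<le> (norm z)\<^sup>2"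
proof -
  have e1: "norm (exp w - 1) \<le> norm w" if "Re w \<le> 0" for w :: complex
  proof -
    have "norm (exp w - exp 0) \<le> 1 * norm (w - 0)"
    proof (rule field_differentiable_bound[of "{z. Re z \<le> 0}" exp exp])
      show "convex {z. Re z \<le> 0}" by (rule convex_halfspace_Re_le)
    qed (use that in \<open>auto intro!: derivative_eq_intros\<close>)
    then show ?thesis by simp
  qed
  have "norm ((exp z - z) - (exp 0 - 0)) \<le> norm z * norm (z - 0)"
  proof (rule field_differentiable_bound[of "closed_segment 0 z" _ "\<lambda>w. exp w - 1"])
    fix w assume "w \<in> closed_segment 0 z"
    then obtain t where t: "0 \<le> t" "t \<le> 1" "w = t *\<^sub>R z" by (auto simp: in_segment)
    have "Re w \<le> 0" using t z by (simp add: mult_nonneg_nonpos)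
    from e1[OF this] show "norm (exp w - 1) \<le> norm z"
      using t mult_right_mono[of t 1 "norm z"] by (simp add: order_trans)
  qed (auto intro!: derivative_eq_intros)
  then show ?thesis by (simp add: power2_eq_square algebra_simps)
qed

section \<open>Truncation and the Levy integrand\<close>

text \<open>Written as clamping to [-1, 1], the truncation is visibly continuous.\<close>

lemma trunc_h_nth: "trunc_h \<xi> $ k = max (-1) (min 1 (\<xi> $ k))"
  by (auto simp: trunc_h_def min_def max_def)

lemma trunc_h_measurable [measurable]: "trunc_h \<in> borel_measurable borel"
proof (rule borel_measurable_continuous_onI)
  show "continuous_on UNIV (trunc_h :: real^'n \<Rightarrow> _)"
    unfolding trunc_h_def
  proof (rule continuous_on_vec_lambda)
    fix k
    have "continuous_on UNIV (\<lambda>\<xi>::real^'n. max (-1) (min 1 (\<xi> $ k)))"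
      by (intro continuous_intros)
    then show "continuous_on UNIV (\<lambda>\<xi>::real^'n. if \<xi> $ k = 0 then 0 else min 1 \<bar>\<xi> $ k\<bar> * (\<xi> $ k / \<bar>\<xi> $ k\<bar>))"
      by (simp add: trunc_h_nth[unfolded trunc_h_def vec_lambda_beta])
  qed
qed

lemma trunc_h_nth_measurable [measurable]: "(\<lambda>\<xi>. trunc_h \<xi> $ k) \<in> borel_measurable borel"
  unfolding trunc_h_nth by measurable

lemma trunc_h_eq_0_iff [simp]: "trunc_h \<xi> = 0 \<longleftrightarrow> \<xi> = 0"
proof -
  have "max (-1) (min 1 x) = 0 \<longleftrightarrow> x = 0" for x :: real by (auto simp: max_def min_def)
  then show ?thesis by (simp add: vec_eq_iff trunc_h_nth)
qed

lemma trunc_h_0 [simp]: "trunc_h 0 = 0"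
  by simp

lemma norm_sum_mult_of_real_le:
  fixes u :: "complex^'d::finite" and h :: "real^'d"
  shows "norm (\<Sum>k\<in>UNIV. u $ k * of_real (h $ k)) \<le> norm u * norm h"
proof -
  have "norm (\<Sum>k\<in>UNIV. u $ k * of_real (h $ k)) \<le> (\<Sum>k\<in>UNIV. \<bar>norm (u $ k)\<bar> * \<bar>norm (h $ k)\<bar>)"
    by (rule order_trans[OF norm_sum]) (simp add: norm_mult)
  also have "\<dots> \<le> norm u * norm h"
    unfolding norm_vec_def by (rule L2_set_mult_ineq)
  finally show ?thesis .
qed

text \<open>For small jumps the truncation is the identity and the second-order estimate of exp
  applies. For the others the truncated jump has norm at least 1, so bounded and linear terms are
  absorbed by its square. The bound separates u from \<xi>, with the factor in \<xi> integrable
  against every Levy measure.\<close>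

lemma norm_levy_integrand_le:
  fixes u :: "complex^'d::finite" and \<xi> :: "real^'d"
  assumes "Re (\<Sum>k\<in>UNIV. u $ k * of_real (\<xi> $ k)) \<le> 0"
  shows "norm (exp (\<Sum>k\<in>UNIV. u $ k * of_real (\<xi> $ k)) - 1 - (\<Sum>k\<in>UNIV. u $ k * of_real (trunc_h \<xi> $ k)))
     \<le> 3 * (1 + (norm u)\<^sup>2) * (norm (trunc_h \<xi>))\<^sup>2"
proof (cases "\<forall>k. \<bar>\<xi> $ k\<bar> \<le> 1")
  case True
  have "-1 \<le> \<xi> $ k \<and> \<xi> $ k \<le> 1" for k using spec[OF True, of k] by linarith
  then have h: "trunc_h \<xi> = \<xi>" by (simp add: vec_eq_iff trunc_h_nth)
  let ?z = "\<Sum>k\<in>UNIV. u $ k * of_real (\<xi> $ k)"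
  have "norm (exp ?z - 1 - ?z) \<le> (norm ?z)\<^sup>2"
    by (rule norm_exp_minus_one_minus_self_le[OF assms])
  also have "\<dots> \<le> (norm u * norm \<xi>)\<^sup>2"
    by (intro power_mono norm_sum_mult_of_real_le) auto
  also have "\<dots> \<le> 3 * (1 + (norm u)\<^sup>2) * (norm \<xi>)\<^sup>2"
    unfolding power_mult_distrib by (intro mult_right_mono) (auto simp: algebra_simps)
  finally show ?thesis by (simp add: h)
next
  case False
  then obtain k where "1 < \<bar>\<xi> $ k\<bar>" by (auto simp: not_le)
  then have "\<bar>trunc_h \<xi> $ k\<bar> = 1" by (auto simp: trunc_h_nth max_def min_def)
  then have h1: "1 \<le> norm (trunc_h \<xi>)" using component_le_norm_cart[of "trunc_h \<xi>" k] by simp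
  let ?H = "norm (trunc_h \<xi>)" and ?U = "norm u"
  have "norm (exp (\<Sum>k\<in>UNIV. u $ k * of_real (\<xi> $ k)) - 1 - (\<Sum>k\<in>UNIV. u $ k * of_real (trunc_h \<xi> $ k)))
    \<le> 1 + 1 + ?U * ?H"
    using assms norm_sum_mult_of_real_le[of u "trunc_h \<xi>"]
    by (intro order_trans[OF norm_triangle_ineq4] add_mono) auto
  also have "\<dots> \<le> 2 * ?H\<^sup>2 + (1 + ?U\<^sup>2) * ?H\<^sup>2"
  proof -
    have "1 \<le> ?H\<^sup>2" using h1 by (simp add: one_le_power)
    moreover have "?U \<le> 1 + ?U\<^sup>2" by (smt (verit) sum_squares_bound[of ?U 1] zero_le_power2 power2_eq_square mult_cancel_left1 one_power2 sum_power2_ge_zero norm_ge_zero)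
    moreover have "?H \<le> ?H\<^sup>2" using mult_left_mono[OF h1, of ?H] by (simp add: power2_eq_square)
    ultimately show ?thesis by (intro add_mono mult_mono) auto
  qed
  also have "\<dots> \<le> 3 * (1 + ?U\<^sup>2) * ?H\<^sup>2" by (simp add: algebra_simps)
  finally show ?thesis .
qed

section \<open>Exponents bounded on the state space, and R on them\<close>

text \<open>These are the exponents u for which the exponential of the pairing with u is bounded on
  the state space.\<close>

definition left_cone :: "'d::finite set \<Rightarrow> (complex^'d) set" where
  "left_cone I = {u. (\<forall>k\<in>I. Re (u $ k) \<le> 0) \<and> (\<forall>k. k \<notin> I \<longrightarrow> Re (u $ k) = 0)}"

text \<open>The real points of \<open>left_cone\<close>; for arguments here Laplace transforms
  exist. It is the set R_-^m x {0} in which the solutions g take their values.\<close>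

definition neg_cone :: "'d::finite set \<Rightarrow> (real^'d) set" where
  "neg_cone I = {u. (\<forall>k\<in>I. u $ k \<le> 0) \<and> (\<forall>k. k \<notin> I \<longrightarrow> u $ k = 0)}"

lemma Re_pairing_left_cone:
  "u \<in> left_cone I \<Longrightarrow> \<xi> \<in> stateD I \<Longrightarrow> Re (\<Sum>k\<in>UNIV. u $ k * of_real (\<xi> $ k)) \<le> 0"
  unfolding Re_sum
proof (rule sum_nonpos)
  fix k assume "u \<in> left_cone I" "\<xi> \<in> stateD I"
  then show "Re (u $ k * of_real (\<xi> $ k)) \<le> 0"
    by (cases "k \<in> I") (auto simp: left_cone_def stateD_def mult_nonpos_nonneg)
qed

lemma inner_neg_cone_le_0: "u \<in> neg_cone I \<Longrightarrow> \<xi> \<in> stateD I \<Longrightarrow> u \<bullet> \<xi> \<le> 0"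
  unfolding inner_vec_def
proof (rule sum_nonpos)
  fix k assume "u \<in> neg_cone I" "\<xi> \<in> stateD I"
  then show "u $ k \<bullet> \<xi> $ k \<le> 0"
    by (cases "k \<in> I") (auto simp: neg_cone_def stateD_def mult_nonpos_nonneg)
qed

lemma of_real_neg_cone: "u \<in> neg_cone I \<Longrightarrow> (\<chi> l. complex_of_real (u $ l)) \<in> left_cone I"
  by (auto simp: neg_cone_def left_cone_def)

lemma convex_neg_cone: "convex (neg_cone I)"
  by (rule convexI) (auto simp: neg_cone_def add_nonpos_nonpos mult_nonneg_nonpos)

lemma stateD_measurable [measurable]: "stateD I \<in> sets borel"
proof -
  have "stateD I = (\<Inter>i\<in>I. {x. 0 \<le> x $ i})" by (auto simp: stateD_def)
  also have "closed \<dots>"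
    by (intro closed_INT ballI closed_Collect_le continuous_intros)
  finally show ?thesis by (rule borel_closed)
qed

text \<open>A real-valued twin of R, because convexity and comparison of solutions need an order on
  the values.\<close>

definition real_Rfun ::
  "('d::finite option \<Rightarrow> real^'d^'d) \<Rightarrow> ('d option \<Rightarrow> real^'d)
     \<Rightarrow> ('d option \<Rightarrow> real) \<Rightarrow> ('d option \<Rightarrow> (real^'d) measure)
     \<Rightarrow> 'd option \<Rightarrow> real^'d \<Rightarrow> real" where
  "real_Rfun alpha beta gamma kappa j u =
     (1/2) * (u \<bullet> (alpha j *v u)) + beta j \<bullet> u - gamma j
     + (\<integral>\<xi>. exp (u \<bullet> \<xi>) - 1 - u \<bullet> trunc_h \<xi> \<partial>kappa j)"

lemma inner_eq_sum_nth: "(x::real^'d::finite) \<bullet> y = (\<Sum>k\<in>UNIV. x $ k * y $ k)"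
  by (simp add: inner_vec_def)

lemma Rfun_of_real:
  "Rfun alpha beta gamma kappa j (\<chi> l. complex_of_real (u $ l))
     = complex_of_real (real_Rfun alpha beta gamma kappa j u)"
proof -
  have quad: "(\<Sum>k\<in>UNIV. \<Sum>l\<in>UNIV. of_real (alpha j $ k $ l) * complex_of_real (u $ l) * complex_of_real (u $ k))
     = of_real (u \<bullet> (alpha j *v u))"
    by (simp add: inner_eq_sum_nth matrix_vector_mult_def sum_distrib_left sum_distrib_right mult_ac)
  have "(\<integral>\<xi>. exp (\<Sum>k\<in>UNIV. complex_of_real (u $ k) * of_real (\<xi> $ k)) - 1
              - (\<Sum>k\<in>UNIV. complex_of_real (u $ k) * of_real (trunc_h \<xi> $ k)) \<partial>kappa j)
      = (\<integral>\<xi>. complex_of_real (exp (u \<bullet> \<xi>) - 1 - u \<bullet> trunc_h \<xi>) \<partial>kappa j)"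
    by (simp add: inner_eq_sum_nth flip: exp_of_real)
  then show ?thesis
    unfolding Rfun_def real_Rfun_def vec_lambda_beta quad
    by (simp only: integral_complex_of_real) (simp add: inner_eq_sum_nth mult.commute)
qed

locale affine_parameters =
  fixes I :: "'d::finite set"
    and alpha :: "'d option \<Rightarrow> real^'d^'d" and beta :: "'d option \<Rightarrow> real^'d"
    and gamma :: "'d option \<Rightarrow> real" and kappa :: "'d option \<Rightarrow> (real^'d) measure"
  assumes adm: "admissible I alpha beta gamma kappa"
begin

abbreviation "R \<equiv> Rfun alpha beta gamma kappa"
abbreviation "rR \<equiv> real_Rfun alpha beta gamma kappa"

lemma sets_kappa [measurable_cong, simp]: "sets (kappa j) = sets borel"
  using adm by (simp add: admissible_def)

lemma space_kappa [simp]: "space (kappa j) = UNIV"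
  using sets_eq_imp_space_eq[OF sets_kappa] by simp

lemma AE_kappa: "AE \<xi> in kappa j. \<xi> \<in> stateD I"
proof (rule AE_I)
  show "emeasure (kappa j) (UNIV - (stateD I - {0})) = 0"
    using adm by (simp add: admissible_def)
qed auto

lemma integrable_trunc_h_square: "integrable (kappa j) (\<lambda>\<xi>. (norm (trunc_h \<xi>))\<^sup>2)"
proof (rule integrableI_nonneg)
  show "(\<integral>\<^sup>+ \<xi>. ennreal ((norm (trunc_h \<xi>))\<^sup>2) \<partial>kappa j) < \<infinity>"
  proof (cases "\<exists>i. j = Some i \<and> i \<notin> I")
    case True
    then have "\<forall>A. emeasure (kappa j) A = 0" using adm by (auto simp: admissible_def)
    then have "kappa j = null_measure (kappa j)" by (intro measure_eqI) auto
    then have "(\<integral>\<^sup>+ \<xi>. ennreal ((norm (trunc_h \<xi>))\<^sup>2) \<partial>kappa j) = 0"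
      by (metis nn_integral_null_measure)
    then show ?thesis by simp
  next
    case False
    then have "j = None \<or> (\<exists>i\<in>I. j = Some i)" by (cases j) auto
    then show ?thesis using adm unfolding admissible_def by blast
  qed
qed auto

lemma integrable_levy_integrand:
  assumes u: "u \<in> left_cone I"
  shows "integrable (kappa j) (\<lambda>\<xi>. exp (\<Sum>k\<in>UNIV. u $ k * of_real (\<xi> $ k)) - 1
              - (\<Sum>k\<in>UNIV. u $ k * of_real (trunc_h \<xi> $ k)))"
proof (rule Bochner_Integration.integrable_bound)
  show "integrable (kappa j) (\<lambda>\<xi>. 3 * (1 + (norm u)\<^sup>2) * (norm (trunc_h \<xi>))\<^sup>2)"
    by (intro integrable_mult_right integrable_trunc_h_square)
  show "AE \<xi> in kappa j. norm (exp (\<Sum>k\<in>UNIV. u $ k * of_real (\<xi> $ k)) - 1 - (\<Sum>k\<in>UNIV. u $ k * of_real (trunc_h \<xi> $ k)))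
     \<le> norm (3 * (1 + (norm u)\<^sup>2) * (norm (trunc_h \<xi>))\<^sup>2)"
    using AE_kappa[of j]
  proof eventually_elim
    case (elim \<xi>)
    from norm_levy_integrand_le[OF Re_pairing_left_cone[OF u elim]] show ?case by simp
  qed
qed measurable

lemma integrable_real_levy_integrand:
  assumes "u \<in> neg_cone I"
  shows "integrable (kappa j) (\<lambda>\<xi>. exp (u \<bullet> \<xi>) - 1 - u \<bullet> trunc_h \<xi>)"
proof -
  have "integrable (kappa j) (\<lambda>\<xi>. Re (exp (\<Sum>k\<in>UNIV. (\<chi> l. complex_of_real (u $ l)) $ k * of_real (\<xi> $ k)) - 1
              - (\<Sum>k\<in>UNIV. (\<chi> l. complex_of_real (u $ l)) $ k * of_real (trunc_h \<xi> $ k))))"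
    by (intro integrable_Re integrable_levy_integrand of_real_neg_cone assms)
  moreover have "Re (exp (\<Sum>k\<in>UNIV. (\<chi> l. complex_of_real (u $ l)) $ k * of_real (\<xi> $ k)) - 1
              - (\<Sum>k\<in>UNIV. (\<chi> l. complex_of_real (u $ l)) $ k * of_real (trunc_h \<xi> $ k)))
     = exp (u \<bullet> \<xi>) - 1 - u \<bullet> trunc_h \<xi>" for \<xi>
  proof -
    have "(\<Sum>k\<in>UNIV. complex_of_real (u $ k) * of_real (\<zeta> $ k)) = of_real (u \<bullet> \<zeta>)" for \<zeta> :: "real^'d"
      by (simp add: inner_eq_sum_nth)
    then show ?thesis by (simp only: vec_lambda_beta) (simp add: Re_exp)
  qed
  ultimately show ?thesis by (simp only:)
qed

text \<open>The quadratic form and the Levy integral both contribute at quadratic order. Summing the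
  individual constants over all indices gives one constant for every j.\<close>

lemma R_quadratic_growth:
  obtains C where "0 < C" "\<And>j u. u \<in> left_cone I \<Longrightarrow> norm (R j u) \<le> C * (1 + (norm u)\<^sup>2)"
proof -
  define Cj where "Cj j = (\<Sum>k\<in>UNIV. \<Sum>l\<in>UNIV. \<bar>alpha j $ k $ l\<bar>) + (\<Sum>k\<in>UNIV. \<bar>beta j $ k\<bar>) + \<bar>gamma j\<bar>
      + 3 * (\<integral>\<xi>. (norm (trunc_h \<xi>))\<^sup>2 \<partial>kappa j)" for j
  have Cj0: "0 \<le> Cj j" for j unfolding Cj_def by (intro add_nonneg_nonneg sum_nonneg) auto
  have bnd: "norm (R j u) \<le> Cj j * (1 + (norm u)\<^sup>2)" if u: "u \<in> left_cone I" for j u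
  proof -
    let ?U = "1 + (norm u)\<^sup>2"
    have U1: "norm u \<le> ?U" by (smt (verit) sum_squares_bound[of "norm u" 1] zero_le_power2 one_power2 mult_cancel_left1 norm_ge_zero)
    have n: "norm (u $ k) \<le> norm u" for k by (rule Finite_Cartesian_Product.norm_nth_le)
    have *: "norm (\<Sum>k\<in>UNIV. \<Sum>l\<in>UNIV. of_real (alpha j $ k $ l) * u $ l * u $ k)
      \<le> (\<Sum>k\<in>UNIV. \<Sum>l\<in>UNIV. \<bar>alpha j $ k $ l\<bar> * ?U)"
    proof (intro sum_norm_le)
      fix k l
      have "norm (u $ l) * norm (u $ k) \<le> norm u * norm u" by (intro mult_mono n) auto
      also have "\<dots> \<le> ?U" by (simp add: power2_eq_square)
      finally show "norm (of_real (alpha j $ k $ l) * u $ l * u $ k) \<le> \<bar>alpha j $ k $ l\<bar> * ?U"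
        by (simp add: norm_mult mult.assoc mult_left_mono)
    qed
    have a: "norm ((1/2) * (\<Sum>k\<in>UNIV. \<Sum>l\<in>UNIV. of_real (alpha j $ k $ l) * u $ l * u $ k))
       \<le> (\<Sum>k\<in>UNIV. \<Sum>l\<in>UNIV. \<bar>alpha j $ k $ l\<bar>) * ?U"
    proof -
      have "0 \<le> (\<Sum>k\<in>UNIV. \<Sum>l\<in>UNIV. \<bar>alpha j $ k $ l\<bar> * ?U)" by (intro sum_nonneg) auto
      with * show ?thesis unfolding norm_mult sum_distrib_right by simp
    qed
    have b: "norm (\<Sum>k\<in>UNIV. of_real (beta j $ k) * u $ k) \<le> (\<Sum>k\<in>UNIV. \<bar>beta j $ k\<bar>) * ?U"
      unfolding sum_distrib_right
    proof (intro sum_norm_le)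
      fix k show "norm (of_real (beta j $ k) * u $ k) \<le> \<bar>beta j $ k\<bar> * ?U"
        using n[of k] U1 by (simp add: norm_mult mult_left_mono)
    qed
    have c: "norm (complex_of_real (gamma j)) \<le> \<bar>gamma j\<bar> * ?U"
      by (simp add: distrib_left)
    have "norm (\<integral>\<xi>. exp (\<Sum>k\<in>UNIV. u $ k * of_real (\<xi> $ k)) - 1
              - (\<Sum>k\<in>UNIV. u $ k * of_real (trunc_h \<xi> $ k)) \<partial>kappa j)
       \<le> (\<integral>\<xi>. 3 * ?U * (norm (trunc_h \<xi>))\<^sup>2 \<partial>kappa j)"
    proof (intro order_trans[OF integral_norm_bound] integral_mono_AE)
      show "AE \<xi> in kappa j. norm (exp (\<Sum>k\<in>UNIV. u $ k * of_real (\<xi> $ k)) - 1 - (\<Sum>k\<in>UNIV. u $ k * of_real (trunc_h \<xi> $ k)))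
       \<le> 3 * (1 + (norm u)\<^sup>2) * (norm (trunc_h \<xi>))\<^sup>2"
        using AE_kappa[of j] by eventually_elim (rule norm_levy_integrand_le[OF Re_pairing_left_cone[OF u]])
    qed (intro integrable_norm integrable_levy_integrand integrable_mult_right integrable_trunc_h_square u)+
    then have d: "norm (\<integral>\<xi>. exp (\<Sum>k\<in>UNIV. u $ k * of_real (\<xi> $ k)) - 1
              - (\<Sum>k\<in>UNIV. u $ k * of_real (trunc_h \<xi> $ k)) \<partial>kappa j)
       \<le> 3 * (\<integral>\<xi>. (norm (trunc_h \<xi>))\<^sup>2 \<partial>kappa j) * ?U"
      by (simp only: integral_mult_right_zero) (simp only: mult_ac)
    show ?thesis
      unfolding Rfun_def Cj_def distrib_right[of _ _ ?U]
      by (intro norm_triangle_mono order_trans[OF norm_triangle_ineq4] add_mono a b c d)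
  qed
  define C where "C = 1 + (\<Sum>j\<in>UNIV. Cj j)"
  have "0 < C" unfolding C_def by (intro add_pos_nonneg sum_nonneg Cj0) auto
  moreover have "norm (R j u) \<le> C * (1 + (norm u)\<^sup>2)" if "u \<in> left_cone I" for j u
  proof -
    have "Cj j \<le> C" unfolding C_def
      using member_le_sum[of j UNIV Cj] Cj0 by simp
    then have "Cj j * (1 + (norm u)\<^sup>2) \<le> C * (1 + (norm u)\<^sup>2)" by (intro mult_right_mono) auto
    with bnd[OF that, of j] show ?thesis by linarith
  qed
  ultimately show thesis by (rule that)
qed

text \<open>Each part is convex: the form because alpha j is positive semidefinite, the Levy
  integral because exp is convex, and the remaining terms are affine. Convexity is what lets a
  convex combination with a barrier turn a solution into a strict supersolution.\<close>

lemma rR_convex: "convex_on (neg_cone I) (rR j)"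
proof (rule convex_onI)
  show "convex (neg_cone I)" by (rule convex_neg_cone)
  fix t :: real and u v assume t: "0 < t" "t < 1" and u: "u \<in> neg_cone I" and v: "v \<in> neg_cone I"
  let ?w = "(1 - t) *\<^sub>R u + t *\<^sub>R v"
  have w: "?w \<in> neg_cone I" using convexD[OF convex_neg_cone u v, of "1-t" t] t by simp
  let ?q = "\<lambda>u. u \<bullet> (alpha j *v u)"
  have sym: "u \<bullet> (alpha j *v v) = v \<bullet> (alpha j *v u)"
  proof -
    have "transpose (alpha j) = alpha j" using adm by (simp add: admissible_def)
    then show ?thesis by (metis dot_lmul_matrix inner_commute vector_transpose_matrix)
  qed
  \<comment> \<open>The convexity defect of a quadratic form at parameter t is exactly t (1 - t)
    times the form at u - v.\<close>
  have "0 \<le> (u - v) \<bullet> (alpha j *v (u - v))" using adm by (simp add: admissible_def)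
  then have "0 \<le> t * (1 - t) * ((u - v) \<bullet> (alpha j *v (u - v)))" using t by simp
  also have "\<dots> = (1 - t) * ?q u + t * ?q v - ?q ?w"
    using sym by (simp add: matrix_vector_right_distrib matrix_vector_mult_diff_distrib matrix_vector_mult_scaleR
        inner_add_left inner_add_right inner_diff_left inner_diff_right algebra_simps)
  finally have q: "?q ?w \<le> (1 - t) * ?q u + t * ?q v" by simp
  let ?i = "\<lambda>u \<xi>. exp (u \<bullet> \<xi>) - 1 - u \<bullet> trunc_h \<xi>"
  have "(\<integral>\<xi>. ?i ?w \<xi> \<partial>kappa j) \<le> (\<integral>\<xi>. (1 - t) * ?i u \<xi> + t * ?i v \<xi> \<partial>kappa j)"
  proof (rule integral_mono)
    fix \<xi>
    have "exp ((1 - t) *\<^sub>R (u \<bullet> \<xi>) + t *\<^sub>R (v \<bullet> \<xi>)) \<le> (1 - t) * exp (u \<bullet> \<xi>) + t * exp (v \<bullet> \<xi>)"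
      using t by (intro convex_onD[OF exp_convex]) auto
    then show "?i ?w \<xi> \<le> (1 - t) * ?i u \<xi> + t * ?i v \<xi>"
      by (simp add: inner_add_left algebra_simps)
  qed (intro integrable_real_levy_integrand w u v integrable_add integrable_mult_right Bochner_Integration.integrable_add)+
  also have "\<dots> = (1 - t) * (\<integral>\<xi>. ?i u \<xi> \<partial>kappa j) + t * (\<integral>\<xi>. ?i v \<xi> \<partial>kappa j)"
    by (subst Bochner_Integration.integral_add)
       (intro integrable_real_levy_integrand u v integrable_mult_right | simp)+
  finally have i: "(\<integral>\<xi>. ?i ?w \<xi> \<partial>kappa j) \<le> (1 - t) * (\<integral>\<xi>. ?i u \<xi> \<partial>kappa j) + t * (\<integral>\<xi>. ?i v \<xi> \<partial>kappa j)" .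
  show "rR j ?w \<le> (1 - t) * rR j u + t * rR j v"
  proof -
    have gen: "(1/2) * A + B - g + i \<le> (1-t) * ((1/2) * A1 + B1 - g + i1) + t * ((1/2) * A2 + B2 - g + i2)"
      if "A \<le> (1-t) * A1 + t * A2" "B = (1-t) * B1 + t * B2" "i \<le> (1-t) * i1 + t * i2"
      for A A1 A2 B B1 B2 i i1 i2 g :: real
    proof -
      have eq: "(1-t) * ((1/2) * A1 + B1 - g + i1) + t * ((1/2) * A2 + B2 - g + i2)
        = (1/2) * ((1-t) * A1 + t * A2) + ((1-t) * B1 + t * B2) - g + ((1-t) * i1 + t * i2)"
        by (simp add: field_simps)
      show ?thesis unfolding eq using that by (intro add_mono diff_mono mult_left_mono) auto
    qed
    show ?thesis
      unfolding real_Rfun_def by (rule gen[OF q _ i]) (simp add: inner_add_right)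
  qed
qed

text \<open>Admissibility makes the first-order compensator integrable in the coordinates of I, so
  it can be merged into the drift, which becomes nonnegative; what remains of the jump integrand is
  exp (u \<bullet> \<xi>) - 1, which is at most 0. Thanks to this sign, the term independent of the
  starting point can be bounded by c h for any c > 0, without following a second equation.\<close>

lemma rR_None_nonpos:
  assumes u: "u \<in> neg_cone I"
  shows "rR None u \<le> 0"
proof -
  \<comment> \<open>Entries with both indices in I vanish by admissibility at index None; all other
    products vanish because u is zero outside I.\<close>
  have "alpha None $ k $ l * u $ l * u $ k = 0" for k l
    using adm u by (cases "k \<in> I"; cases "l \<in> I") (auto simp: admissible_def neg_cone_def)
  then have q: "u \<bullet> (alpha None *v u) = 0"
  proof -
    assume *: "\<And>k l. alpha None $ k $ l * u $ l * u $ k = 0"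
    have "u \<bullet> (alpha None *v u) = (\<Sum>k\<in>UNIV. \<Sum>l\<in>UNIV. alpha None $ k $ l * u $ l * u $ k)"
      by (simp add: inner_eq_sum_nth matrix_vector_mult_def sum_distrib_left mult_ac)
    then show ?thesis by (simp only: * sum.neutral_const)
  qed
  have hint: "integrable (kappa None) (\<lambda>\<xi>. trunc_h \<xi> $ k)" if "k \<in> I" for k
  proof -
    have "(\<integral>\<^sup>+ \<xi>. ennreal \<bar>trunc_h \<xi> $ k\<bar> \<partial>kappa None) < \<infinity>"
      using adm that unfolding admissible_def by blast
    then show ?thesis by (intro integrableI_bounded) auto
  qed
  have uhint: "integrable (kappa None) (\<lambda>\<xi>. u $ k * trunc_h \<xi> $ k)" for k
    using hint[of k] u by (cases "k \<in> I") (auto simp: neg_cone_def)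
  have "(\<integral>\<xi>. exp (u \<bullet> \<xi>) - 1 - u \<bullet> trunc_h \<xi> \<partial>kappa None)
     \<le> (\<integral>\<xi>. - (\<Sum>k\<in>UNIV. u $ k * trunc_h \<xi> $ k) \<partial>kappa None)"
  proof (rule integral_mono_AE)
    show "AE \<xi> in kappa None. exp (u \<bullet> \<xi>) - 1 - u \<bullet> trunc_h \<xi> \<le> - (\<Sum>k\<in>UNIV. u $ k * trunc_h \<xi> $ k)"
      using AE_kappa[of None]
      by eventually_elim (use inner_neg_cone_le_0[OF u] in \<open>auto simp: inner_eq_sum_nth\<close>)
  qed (use u uhint in \<open>auto intro!: integrable_real_levy_integrand\<close>)
  also have "\<dots> = - (\<Sum>k\<in>UNIV. u $ k * (\<integral>\<xi>. trunc_h \<xi> $ k \<partial>kappa None))"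
    using uhint by simp
  finally have "rR None u \<le> (\<Sum>k\<in>UNIV. u $ k * (beta None $ k - (\<integral>\<xi>. trunc_h \<xi> $ k \<partial>kappa None))) - gamma None"
    unfolding real_Rfun_def q
    by (simp add: inner_eq_sum_nth[of "beta None"] right_diff_distrib sum_subtractf mult.commute[of "beta None $ _"])
  also have "\<dots> \<le> 0"
  proof -
    have "u $ k * (beta None $ k - (\<integral>\<xi>. trunc_h \<xi> $ k \<partial>kappa None)) \<le> 0" for k
    proof (cases "k \<in> I")
      case True
      then have "0 \<le> beta None $ k - (\<integral>\<xi>. trunc_h \<xi> $ k \<partial>kappa None)"
        using adm unfolding admissible_def by blast
      then show ?thesis using u True by (intro mult_nonpos_nonneg) (auto simp: neg_cone_def)
    qed (use u in \<open>auto simp: neg_cone_def\<close>)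
    then have "(\<Sum>k\<in>UNIV. u $ k * (beta None $ k - (\<integral>\<xi>. trunc_h \<xi> $ k \<partial>kappa None))) \<le> 0"
      by (intro sum_nonpos)
    moreover have "0 \<le> gamma None" using adm by (simp add: admissible_def)
    ultimately show ?thesis by simp
  qed
  finally show ?thesis .
qed

end

section \<open>From R on imaginary rays to R at real arguments\<close>

text \<open>The polynomial part is sorted by powers of i w because these are the moments that the
  kernel evaluates.\<close>

lemma (in affine_parameters) Rfun_imaginary_ray:
  "R j (\<chi> l. \<i> * of_real ((w *\<^sub>R a) $ l))
     = (\<i> * of_real w) ^ 2 * of_real ((1/2) * (a \<bullet> (alpha j *v a))) + (\<i> * of_real w) * of_real (beta j \<bullet> a)
       - of_real (gamma j)
       + (\<integral>\<xi>. exp (\<i> * of_real (w * (a \<bullet> \<xi>))) - 1 - \<i> * of_real (w * (a \<bullet> trunc_h \<xi>)) \<partial>kappa j)"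
proof -
  have lin: "(\<Sum>k\<in>UNIV. \<i> * complex_of_real (w * a $ k) * of_real (\<xi> $ k)) = \<i> * of_real (w * (a \<bullet> \<xi>))" for \<xi> :: "real^'d"
    by (simp add: inner_eq_sum_nth sum_distrib_left mult_ac)
  have quad: "(\<Sum>k\<in>UNIV. \<Sum>l\<in>UNIV. of_real (alpha j $ k $ l) * (\<i> * complex_of_real (w * a $ l)) * (\<i> * complex_of_real (w * a $ k)))
     = (\<i> * of_real w) ^ 2 * of_real (a \<bullet> (alpha j *v a))"
    by (simp add: inner_eq_sum_nth matrix_vector_mult_def sum_distrib_left sum_distrib_right
        power2_eq_square mult_ac sum_negf)
  have b: "(\<Sum>k\<in>UNIV. of_real (beta j $ k) * (\<i> * complex_of_real (w * a $ k))) = (\<i> * of_real w) * of_real (beta j \<bullet> a)"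
    by (simp add: inner_eq_sum_nth sum_distrib_left mult_ac)
  show ?thesis
    unfolding Rfun_def vec_lambda_beta vector_scaleR_component real_scaleR_def lin quad b by simp
qed

lemma norm_levy_integrand_imaginary_le:
  fixes a \<xi> :: "real^'d::finite"
  shows "norm (exp (\<i> * of_real (w * (a \<bullet> \<xi>))) - 1 - \<i> * of_real (w * (a \<bullet> trunc_h \<xi>)))
     \<le> 3 * (1 + (norm a)\<^sup>2) * (norm (trunc_h \<xi>))\<^sup>2 * (1 + w\<^sup>2)"
proof -
  let ?u = "(\<chi> l. \<i> * complex_of_real (w * a $ l)) :: complex^'d"
  have lin: "(\<Sum>k\<in>UNIV. ?u $ k * of_real (\<zeta> $ k)) = \<i> * of_real (w * (a \<bullet> \<zeta>))" for \<zeta> :: "real^'d"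
    by (simp add: inner_eq_sum_nth sum_distrib_left mult_ac)
  have "norm ?u = norm (w *\<^sub>R a)"
    unfolding norm_vec_def by (simp add: norm_mult abs_mult)
  then have nu: "norm ?u = \<bar>w\<bar> * norm a" by simp
  have "norm (exp (\<i> * of_real (w * (a \<bullet> \<xi>))) - 1 - \<i> * of_real (w * (a \<bullet> trunc_h \<xi>)))
     \<le> 3 * (1 + (norm ?u)\<^sup>2) * (norm (trunc_h \<xi>))\<^sup>2"
    using norm_levy_integrand_le[of ?u \<xi>] unfolding lin by simp
  also have "\<dots> \<le> 3 * ((1 + (norm a)\<^sup>2) * (1 + w\<^sup>2)) * (norm (trunc_h \<xi>))\<^sup>2"
    unfolding nu by (intro mult_right_mono mult_left_mono) (auto simp: power_mult_distrib algebra_simps)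
  finally show ?thesis by (simp only: mult_ac)
qed

text \<open>For one fixed jump the integrand consists of exponentials and a term linear in i w, so
  the moments 0 and 1 suffice. The factor exp (i w s) is the characteristic function at time zero;
  in the application s is a \<bullet> x for the starting point x.\<close>

lemma laplace_kernel_levy_integrand:
  fixes a \<xi> h :: "real^'d::finite"
  assumes s: "0 \<le> s" and a: "0 \<le> a \<bullet> \<xi>"
  shows "(\<integral>w. (exp (\<i> * of_real (w * (a \<bullet> \<xi>))) - 1 - \<i> * of_real (w * (a \<bullet> h))) * exp (\<i> * of_real (w * s)) * laplace_kernel w \<partial>lborel)
     = complex_of_real ((exp (- (a \<bullet> \<xi>)) - 1 + a \<bullet> h) * exp (- s))"
proof -
  have i0: "integrable lborel (\<lambda>w. exp (\<i> * of_real (w * r)) * laplace_kernel w)" for r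
    by (rule integrable_times_laplace_kernel[where C=1]) auto
  have i1: "integrable lborel (\<lambda>w. \<i> * of_real w * exp (\<i> * of_real (w * r)) * laplace_kernel w)" for r
  proof (rule integrable_times_laplace_kernel[where C=1])
    fix w :: real
    have "2 * \<bar>w\<bar> \<le> 1 + \<bar>w\<bar>\<^sup>2" using sum_squares_bound[of "\<bar>w\<bar>" 1] by simp
    then have "\<bar>w\<bar> \<le> 1 + w\<^sup>2" unfolding power2_abs by linarith
    then show "norm (\<i> * of_real w * exp (\<i> * of_real (w * r))) \<le> 1 * (1 + w\<^sup>2)"
      by (simp add: norm_mult)
  qed measurable
  have "(\<lambda>w. (exp (\<i> * of_real (w * (a \<bullet> \<xi>))) - 1 - \<i> * of_real (w * (a \<bullet> h))) * exp (\<i> * of_real (w * s)) * laplace_kernel w)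
    = (\<lambda>w. exp (\<i> * of_real (w * (a \<bullet> \<xi> + s))) * laplace_kernel w - exp (\<i> * of_real (w * s)) * laplace_kernel w
         - of_real (a \<bullet> h) * (\<i> * of_real w * exp (\<i> * of_real (w * s)) * laplace_kernel w))"
    by (rule ext) (simp add: algebra_simps exp_add)
  then have "(\<integral>w. (exp (\<i> * of_real (w * (a \<bullet> \<xi>))) - 1 - \<i> * of_real (w * (a \<bullet> h))) * exp (\<i> * of_real (w * s)) * laplace_kernel w \<partial>lborel)
    = (\<integral>w. exp (\<i> * of_real (w * (a \<bullet> \<xi> + s))) * laplace_kernel w \<partial>lborel)
       - (\<integral>w. exp (\<i> * of_real (w * s)) * laplace_kernel w \<partial>lborel)
       - of_real (a \<bullet> h) * (\<integral>w. \<i> * of_real w * exp (\<i> * of_real (w * s)) * laplace_kernel w \<partial>lborel)"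
    by (simp only: Bochner_Integration.integral_diff Bochner_Integration.integrable_diff integrable_mult_right i0 i1 integral_mult_right_zero)
  also have "(\<integral>w. exp (\<i> * of_real (w * (a \<bullet> \<xi> + s))) * laplace_kernel w \<partial>lborel) = of_real (exp (- (a \<bullet> \<xi> + s)))"
    using laplace_kernel_integral[of "a \<bullet> \<xi> + s" 0] s a by simp
  also have "(\<integral>w. exp (\<i> * of_real (w * s)) * laplace_kernel w \<partial>lborel) = of_real (exp (- s))"
    using laplace_kernel_integral[of s 0] s by simp
  also have "(\<integral>w. \<i> * of_real w * exp (\<i> * of_real (w * s)) * laplace_kernel w \<partial>lborel) = - of_real (exp (- s))"
    using laplace_kernel_integral[of s 1] s by simp
  finally show ?thesis
    by (simp add: algebra_simps exp_diff exp_minus flip: exp_of_real) (simp add: divide_inverse exp_minus)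
qed

text \<open>Evaluation at i w = -1 sends the ray i w a to - a: this is the passage from imaginary to
  real arguments. The difficulty is the Levy part, where the kernel integral is exchanged with a
  possibly infinite measure.\<close>

lemma (in affine_parameters) Rfun_kernel_integral:
  assumes s: "0 \<le> s" and a: "- a \<in> neg_cone I"
  shows "integrable lborel (\<lambda>w. R j (\<chi> l. \<i> * of_real ((w *\<^sub>R a) $ l)) * exp (\<i> * of_real (w * s)) * laplace_kernel w)" (is ?th1)
    and "(\<integral>w. R j (\<chi> l. \<i> * of_real ((w *\<^sub>R a) $ l)) * exp (\<i> * of_real (w * s)) * laplace_kernel w \<partial>lborel)
      = complex_of_real (rR j (- a) * exp (- s))" (is ?th2)
proof -
  let ?E = "\<lambda>w. exp (\<i> * complex_of_real (w * s))"
  let ?G = "\<lambda>\<xi> w. exp (\<i> * of_real (w * (a \<bullet> \<xi>))) - 1 - \<i> * of_real (w * (a \<bullet> trunc_h \<xi>))"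
  let ?h = "\<lambda>\<xi>::real^'d. (norm (trunc_h \<xi>))\<^sup>2"
  \<comment> \<open>Weighting the Levy measure makes it finite, so that Fubini applies.\<close>
  define N where "N = density (kappa j) (\<lambda>\<xi>. ennreal (?h \<xi>))"
  have fin: "finite_measure N"
  proof (rule finite_measureI)
    have "emeasure N (space N) = (\<integral>\<^sup>+ \<xi>. ennreal (?h \<xi>) \<partial>kappa j)"
      unfolding N_def by (simp add: emeasure_density)
    also have "\<dots> < \<infinity>" using integrable_trunc_h_square[of j]
      by (simp add: nn_integral_eq_integral)
    finally show "emeasure N (space N) \<noteq> \<infinity>" by simp
  qed
  have setsN [measurable_cong]: "sets N = sets borel" by (simp add: N_def)
  \<comment> \<open>The density vanishes only at the origin, where division by zero yields 0;
    \<open>F 0 = 0\<close> settles that point.\<close>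
  have toN: "(\<integral>\<xi>. F \<xi> \<partial>kappa j) = (\<integral>\<xi>. F \<xi> / of_real (?h \<xi>) \<partial>N)"
    if [measurable]: "F \<in> borel_measurable borel" and F0: "F 0 = 0" for F :: "real^'d \<Rightarrow> complex"
  proof -
    have "(\<integral>\<xi>. F \<xi> / of_real (?h \<xi>) \<partial>N) = (\<integral>\<xi>. ?h \<xi> *\<^sub>R (F \<xi> / of_real (?h \<xi>)) \<partial>kappa j)"
      unfolding N_def by (rule integral_density) auto
    also have "(\<lambda>\<xi>. ?h \<xi> *\<^sub>R (F \<xi> / of_real (?h \<xi>))) = F"
    proof
      fix \<xi> show "?h \<xi> *\<^sub>R (F \<xi> / of_real (?h \<xi>)) = F \<xi>"
        using F0 by (cases "\<xi> = 0") (auto simp: scaleR_conv_of_real)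
    qed
    finally show ?thesis by simp
  qed
  let ?f = "\<lambda>\<xi> w. ?G \<xi> w * ?E w / of_real (?h \<xi>)"
  have fm: "case_prod ?f \<in> borel_measurable (N \<Otimes>\<^sub>M borel)" by measurable
  have fb: "norm (?f \<xi> w) \<le> 3 * (1 + (norm a)\<^sup>2) * (1 + w\<^sup>2)" for \<xi> w
  proof (cases "\<xi> = 0")
    case False
    then have "0 < ?h \<xi>" by simp
    then show ?thesis using norm_levy_integrand_imaginary_le[of w a \<xi>]
      by (simp add: norm_divide norm_mult norm_power divide_le_eq mult_ac)
  qed simp
  have Gint: "(\<integral>\<xi>. ?G \<xi> w \<partial>kappa j) * ?E w = (\<integral>\<xi>. ?f \<xi> w \<partial>N)" for w
    by (subst toN) (auto simp flip: times_divide_eq_left)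
  have I4: "integrable lborel (\<lambda>w. (\<integral>\<xi>. ?G \<xi> w \<partial>kappa j) * ?E w * laplace_kernel w)"
    unfolding Gint by (rule laplace_kernel_Fubini(1)[OF fin fm fb])
  have "(\<integral>w. (\<integral>\<xi>. ?G \<xi> w \<partial>kappa j) * ?E w * laplace_kernel w \<partial>lborel)
     = (\<integral>\<xi>. (\<integral>w. ?f \<xi> w * laplace_kernel w \<partial>lborel) \<partial>N)"
    unfolding Gint by (rule laplace_kernel_Fubini(2)[OF fin fm fb])
  also have "\<dots> = (\<integral>\<xi>. complex_of_real ((exp (- (a \<bullet> \<xi>)) - 1 + a \<bullet> trunc_h \<xi>) * exp (- s)) / of_real (?h \<xi>) \<partial>N)"
  proof (rule integral_cong_AE)
    have "AE \<xi> in N. \<xi> \<in> stateD I"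
      unfolding N_def using AE_kappa[of j] by (subst AE_density) auto
    then show "AE \<xi> in N. (\<integral>w. ?f \<xi> w * laplace_kernel w \<partial>lborel)
       = complex_of_real ((exp (- (a \<bullet> \<xi>)) - 1 + a \<bullet> trunc_h \<xi>) * exp (- s)) / of_real (?h \<xi>)"
    proof eventually_elim
      case (elim \<xi>)
      have "0 \<le> a \<bullet> \<xi>" using inner_neg_cone_le_0[OF a elim] by simp
      note laplace_kernel_levy_integrand[OF s this, of "trunc_h \<xi>"]
      moreover have "(\<lambda>w. ?f \<xi> w * laplace_kernel w) = (\<lambda>w. (?G \<xi> w * ?E w * laplace_kernel w) / of_real (?h \<xi>))"
        by (simp add: mult.commute)
      ultimately show ?case by (simp only: integral_divide_zero)
    qed
    show "(\<lambda>\<xi>. \<integral>w. ?f \<xi> w * laplace_kernel w \<partial>lborel) \<in> borel_measurable N" by measurable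
    show "(\<lambda>\<xi>. complex_of_real ((exp (- (a \<bullet> \<xi>)) - 1 + a \<bullet> trunc_h \<xi>) * exp (- s)) / of_real (?h \<xi>)) \<in> borel_measurable N"
      by measurable
  qed
  also have "\<dots> = (\<integral>\<xi>. complex_of_real ((exp (- (a \<bullet> \<xi>)) - 1 + a \<bullet> trunc_h \<xi>) * exp (- s)) \<partial>kappa j)"
    by (rule toN[symmetric]) auto
  also have "\<dots> = complex_of_real ((\<integral>\<xi>. exp ((- a) \<bullet> \<xi>) - 1 - (- a) \<bullet> trunc_h \<xi> \<partial>kappa j) * exp (- s))"
    by (simp only: integral_complex_of_real integral_mult_left_zero) simp
  finally have V4: "(\<integral>w. (\<integral>\<xi>. ?G \<xi> w \<partial>kappa j) * ?E w * laplace_kernel w \<partial>lborel)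
     = complex_of_real ((\<integral>\<xi>. exp ((- a) \<bullet> \<xi>) - 1 - (- a) \<bullet> trunc_h \<xi> \<partial>kappa j) * exp (- s))" .
  have In: "integrable lborel (\<lambda>w. (\<i> * of_real w) ^ n * ?E w * laplace_kernel w)" if n: "n \<le> 2" for n
  proof (rule integrable_times_laplace_kernel[where C=1])
    fix w :: real
    have "\<bar>w\<bar> ^ n \<le> 1 + w\<^sup>2"
    proof (cases "\<bar>w\<bar> \<le> 1")
      case True
      then have "\<bar>w\<bar> ^ n \<le> 1" by (intro power_le_one) auto
      then show ?thesis by (smt (verit) zero_le_power2)
    next
      case False
      then have "\<bar>w\<bar> ^ n \<le> \<bar>w\<bar> ^ 2" using n by (intro power_increasing) auto
      then show ?thesis by simp
    qed
    then show "norm ((\<i> * of_real w) ^ n * ?E w) \<le> 1 * (1 + w\<^sup>2)"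
      by (simp add: norm_mult norm_power)
  qed measurable
  define q where "q = complex_of_real ((1/2) * (a \<bullet> (alpha j *v a)))"
  define b where "b = complex_of_real (beta j \<bullet> a)"
  define g where "g = complex_of_real (gamma j)"
  have eq: "(\<lambda>w. R j (\<chi> l. \<i> * of_real ((w *\<^sub>R a) $ l)) * ?E w * laplace_kernel w)
    = (\<lambda>w. q * ((\<i> * of_real w) ^ 2 * ?E w * laplace_kernel w) + b * ((\<i> * of_real w) ^ 1 * ?E w * laplace_kernel w)
        - g * ((\<i> * of_real w) ^ 0 * ?E w * laplace_kernel w)
        + (\<integral>\<xi>. ?G \<xi> w \<partial>kappa j) * ?E w * laplace_kernel w)"
    unfolding Rfun_imaginary_ray q_def[symmetric] b_def[symmetric] g_def[symmetric]
    by (rule ext) (simp add: algebra_simps)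
  show ?th1 unfolding eq
    by (intro Bochner_Integration.integrable_add Bochner_Integration.integrable_diff integrable_mult_right In I4) auto
  have "(\<integral>w. R j (\<chi> l. \<i> * of_real ((w *\<^sub>R a) $ l)) * ?E w * laplace_kernel w \<partial>lborel)
     = q * ((-1) ^ 2 * exp (- s)) + b * ((-1) ^ 1 * exp (- s)) - g * ((-1) ^ 0 * exp (- s))
       + complex_of_real ((\<integral>\<xi>. exp ((- a) \<bullet> \<xi>) - 1 - (- a) \<bullet> trunc_h \<xi> \<partial>kappa j) * exp (- s))"
  proof -
    have split: "(\<integral>w. q * f2 w + b * f1 w - g * f0 w + f w \<partial>lborel)
        = q * (\<integral>w. f2 w \<partial>lborel) + b * (\<integral>w. f1 w \<partial>lborel) - g * (\<integral>w. f0 w \<partial>lborel) + (\<integral>w. f w \<partial>lborel)"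
      if "integrable lborel f0" "integrable lborel f1" "integrable lborel f2" "integrable lborel f"
      for f0 f1 f2 f :: "real \<Rightarrow> complex"
      using that by simp
    have n: "(0::nat) \<le> 2" "(1::nat) \<le> 2" "(2::nat) \<le> 2" by auto
    show ?thesis
      unfolding eq split[OF In[OF n(1)] In[OF n(2)] In[OF n(3)] I4] V4
        laplace_kernel_integral[OF s n(1)] laplace_kernel_integral[OF s n(2)] laplace_kernel_integral[OF s n(3)]
      by (rule refl)
  qed
  also have "\<dots> = complex_of_real (rR j (- a) * exp (- s))"
    unfolding real_Rfun_def q_def b_def g_def
    by (simp add: algebra_simps linear_neg[OF matrix_vector_mul_linear])
  finally show ?th2 .
qed

section \<open>Fourier and Laplace transforms of the transition function\<close>

text \<open>Boundedness does the work of continuity: a value above 1 would have unbounded powers, so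
  l is at most 1 and hence decreasing, and monotonicity pins it down between its values at
  integers.\<close>

lemma bounded_multiplicative_imp_exp:
  fixes l :: "real \<Rightarrow> real"
  assumes mult: "\<And>r s. 0 \<le> r \<Longrightarrow> 0 \<le> s \<Longrightarrow> l (r + s) = l r * l s"
    and pos: "\<And>r. 0 \<le> r \<Longrightarrow> 0 < l r" and bnd: "\<And>r. 0 \<le> r \<Longrightarrow> l r \<le> K"
  obtains b where "b \<le> 0" "\<And>r. 0 \<le> r \<Longrightarrow> l r = exp (b * r)"
proof -
  have l0: "l 0 = 1" using mult[of 0 0] pos[of 0] by simp
  have pow: "l (real n * r) = l r ^ n" if "0 \<le> r" for n r
    by (induction n) (use that in \<open>auto simp: l0 mult algebra_simps\<close>)
  have le1: "l r \<le> 1" if r: "0 \<le> r" for r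
  proof (rule ccontr)
    assume "\<not> l r \<le> 1"
    then obtain n where "K < l r ^ n" using real_arch_pow by (meson not_le)
    then show False using pow[OF r, of n] bnd[of "real n * r"] r by simp
  qed
  have mono: "l s \<le> l r" if "0 \<le> r" "r \<le> s" for r s
    using mult[of r "s - r"] le1[of "s - r"] pos[of r] that
    by (metis add_diff_cancel_left' diff_ge_0_iff_ge diff_add_cancel add.commute mult_left_le less_imp_le)
  define b where "b = ln (l 1)"
  have b: "b \<le> 0" using le1[of 1] pos[of 1] by (simp add: b_def)
  have lnpow: "ln (l (real n * r)) = real n * ln (l r)" if "0 \<le> r" for n r
    using pow[OF that] pos[OF that] by (simp add: ln_realpow)
  have "ln (l r) = b * r" if r: "0 \<le> r" for r
  proof (rule ccontr)
    assume "ln (l r) \<noteq> b * r"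
    \<comment> \<open>Bracketing n r between the integers m and m + 1 determines n ln (l r) up to an
      error - b, while n times the supposed gap exceeds - b.\<close>
    then obtain n :: nat where n: "- b < real n * \<bar>ln (l r) - b * r\<bar>"
      using reals_Archimedean3[of "\<bar>ln (l r) - b * r\<bar>"] by auto
    define m where "m = nat \<lfloor>real n * r\<rfloor>"
    have m: "real m \<le> real n * r" "real n * r \<le> real (Suc m)"
      using r by (auto simp: m_def) linarith
    have "ln (l (real n * r)) \<le> ln (l (real m * 1))"
      using mono[of "real m" "real n * r"] m pos[of "real n * r"] pos[of "real m"] r by simp
    moreover have "ln (l (real (Suc m) * 1)) \<le> ln (l (real n * r))"
      using mono[of "real n * r" "real (Suc m)"] m pos[of "real n * r"] pos[of "real (Suc m)"] r by simp
    ultimately have "real n * ln (l r) \<le> real m * b" "real (Suc m) * b \<le> real n * ln (l r)"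
      unfolding lnpow[OF r] lnpow[OF zero_le_one] b_def by simp_all
    moreover have "real n * r * b \<le> real m * b" "real (Suc m) * b \<le> real n * r * b"
      using m b by (intro mult_right_mono_neg; simp)+
    ultimately have "\<bar>real n * ln (l r) - real n * r * b\<bar> \<le> - b"
      by (simp add: algebra_simps abs_le_iff)
    moreover have "\<bar>real n * ln (l r) - real n * r * b\<bar> = real n * \<bar>ln (l r) - b * r\<bar>"
    proof -
      have "real n * ln (l r) - real n * r * b = real n * (ln (l r) - b * r)"
        by (simp add: algebra_simps)
      then show ?thesis by (simp only: abs_mult abs_of_nat)
    qed
    ultimately show False using n by simp
  qed
  then have "l r = exp (b * r)" if "0 \<le> r" for r
    using pos[OF that] that by (metis exp_ln)
  with b show thesis by (rule that)
qed

lemma integral_pair_measure_mult: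
  fixes f :: "'a \<Rightarrow> 'c::{real_normed_field,banach,second_countable_topology}" and g :: "'b \<Rightarrow> 'c"
  assumes "finite_measure M" "finite_measure N" and f: "integrable M f" and g: "integrable N g"
  shows "(\<integral>z. f (fst z) * g (snd z) \<partial>(M \<Otimes>\<^sub>M N)) = (\<integral>x. f x \<partial>M) * (\<integral>y. g y \<partial>N)"
proof -
  interpret M: finite_measure M by fact
  interpret N: finite_measure N by fact
  interpret pair_sigma_finite M N ..
  have [measurable]: "f \<in> borel_measurable M" "g \<in> borel_measurable N" using f g by auto
  have int: "integrable (M \<Otimes>\<^sub>M N) (\<lambda>(x, y). f x * g y)"
  proof (rule Fubini_integrable)
    show "AE x in M. integrable N (\<lambda>y. case (x, y) of (x, y) \<Rightarrow> f x * g y)"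
      using g by auto
    show "integrable M (\<lambda>x. \<integral>y. norm (case (x, y) of (x, y) \<Rightarrow> f x * g y) \<partial>N)"
      using f by (auto simp: norm_mult)
  qed measurable
  have "(\<integral>x. (\<integral>y. f x * g y \<partial>N) \<partial>M) = (\<integral>z. (case z of (x, y) \<Rightarrow> f x * g y) \<partial>(M \<Otimes>\<^sub>M N))"
    using integral_fst'[OF int] by simp
  then show ?thesis by (simp add: case_prod_beta)
qed

text \<open>The derivative is controlled only while the norm is at most 2 M. At the first time the
  norm reaches 2 M, the mean value theorem allows an increment of at most h B, hence at most M, from
  a start strictly below M, which is a contradiction.\<close>

lemma norm_le_until_from_derivative_bound:
  fixes f :: "real \<Rightarrow> 'a::real_inner"
  assumes der: "\<And>t. 0 \<le> t \<Longrightarrow> (f has_vector_derivative f' t) (at t within {0..})"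
    and bnd: "\<And>t. 0 < t \<Longrightarrow> norm (f t) \<le> 2 * M \<Longrightarrow> norm (f' t) \<le> B"
    and init: "norm (f 0) < M" and B: "0 \<le> B" "h * B \<le> M" and s: "0 \<le> s" "s \<le> h"
  shows "norm (f s) \<le> 2 * M"
proof (rule ccontr)
  assume "\<not> norm (f s) \<le> 2 * M"
  have cont: "continuous_on {0..} f"
    by (rule continuous_on_vector_derivative[of _ _ f']) (use der in auto)
  define S where "S = {t \<in> {0..s}. 2 * M \<le> norm (f t)}"
  have "closed ({0..s} \<inter> (\<lambda>t. norm (f t)) -` {2 * M..})"
    by (intro continuous_closed_preimage continuous_intros continuous_on_subset[OF cont]) auto
  also have "{0..s} \<inter> (\<lambda>t. norm (f t)) -` {2 * M..} = S" by (auto simp: S_def)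
  finally have "closed S" .
  moreover have "s \<in> S" using s \<open>\<not> norm (f s) \<le> 2 * M\<close> by (auto simp: S_def)
  moreover have bb: "bdd_below S" by (rule bdd_belowI[of _ 0]) (auto simp: S_def)
  ultimately have inS: "Inf S \<in> S" by (intro closed_contains_Inf) auto
  define t where "t = Inf S"
  have t: "0 \<le> t" "t \<le> s" "2 * M \<le> norm (f t)" using inS by (auto simp: S_def t_def)
  have M: "0 < M" using init norm_ge_zero[of "f 0"] by linarith
  have "t \<noteq> 0" using t init M by auto
  then have t0: "0 < t" using t by simp
  have before: "norm (f r) \<le> 2 * M" if "0 < r" "r < t" for r
  proof (rule ccontr)
    assume "\<not> norm (f r) \<le> 2 * M"
    then have "r \<in> S" using that t by (auto simp: S_def)
    then have "t \<le> r" unfolding t_def by (intro cInf_lower bb)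
    then show False using that by simp
  qed
  have "\<exists>r\<in>{0<..<t}. norm (f t - f 0) \<le> norm ((t - 0) *\<^sub>R f' r)"
  proof (rule mvt_general[OF t0])
    show "continuous_on {0..t} f" by (rule continuous_on_subset[OF cont]) auto
    fix r assume "0 < r" "r < t"
    then show "(f has_derivative (\<lambda>x. x *\<^sub>R f' r)) (at r)"
      using der[of r] at_within_interior[of r "{0..}"] by (simp add: has_vector_derivative_def)
  qed
  then obtain r where r: "0 < r" "r < t" "norm (f t - f 0) \<le> t * norm (f' r)" using t0 by auto
  have "norm (f t - f 0) \<le> h * B"
    using r(3) mult_mono[of t h "norm (f' r)" B] bnd[OF r(1) before[OF r(1,2)]] t s B by auto
  then have "norm (f t) < 2 * M"
    using norm_triangle_sub[of "f t" "f 0"] init B by linarith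
  with t show False by simp
qed

lemma has_vector_derivative_right_sequence:
  assumes "(f has_vector_derivative D) (at 0 within {0..})" and X: "\<And>n. 0 < X n" "X \<longlonglongrightarrow> 0"
  shows "(\<lambda>n. (f (X n) - f 0) /\<^sub>R X n) \<longlonglongrightarrow> D"
proof -
  have "((\<lambda>y. ((f y - f 0) - (y - 0) *\<^sub>R D) /\<^sub>R norm (y - 0)) \<longlongrightarrow> 0) (at 0 within {0..})"
    using assms(1) unfolding has_vector_derivative_def has_derivative_at_within by blast
  then have "(\<lambda>n. ((f (X n) - f 0) - X n *\<^sub>R D) /\<^sub>R norm (X n)) \<longlonglongrightarrow> 0"
    unfolding tendsto_at_iff_sequentially comp_def using X by (auto simp: less_imp_le less_imp_neq[THEN not_sym])
  moreover have "((f (X n) - f 0) - X n *\<^sub>R D) /\<^sub>R norm (X n) = (f (X n) - f 0) /\<^sub>R X n - D" for n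
    using X(1)[of n] by (simp add: scaleR_diff_right)
  ultimately show ?thesis by (subst Lim_null) simp
qed

lemma axis_in_stateD: "0 \<le> r \<or> k \<notin> I \<Longrightarrow> axis k r \<in> stateD I"
  by (auto simp: stateD_def axis_def)

lemma zero_in_stateD [simp]: "0 \<in> stateD I"
  by (simp add: stateD_def)

lemma stateD_add: "x \<in> stateD I \<Longrightarrow> y \<in> stateD I \<Longrightarrow> x + y \<in> stateD I"
  by (simp add: stateD_def)

lemma sum_mult_axis: "(\<Sum>k\<in>UNIV. (u::complex^'d::finite) $ k * of_real (axis i r $ k)) = u $ i * of_real r"
proof -
  have "(\<Sum>k\<in>UNIV. u $ k * of_real (axis i r $ k)) = (\<Sum>k\<in>UNIV. if k = i then u $ k * of_real r else 0)"
    by (intro sum.cong) (auto simp: axis_def)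
  then show ?thesis by simp
qed

section \<open>The characteristic function in time\<close>

locale affine_process = affine_parameters I alpha beta gamma kappa
  for I :: "'d::finite set"
    and alpha :: "'d option \<Rightarrow> real^'d^'d" and beta :: "'d option \<Rightarrow> real^'d"
    and gamma :: "'d option \<Rightarrow> real" and kappa :: "'d option \<Rightarrow> (real^'d) measure" +
  fixes p :: "real \<Rightarrow> real^'d \<Rightarrow> (real^'d) measure"
    and psi0 :: "real \<Rightarrow> real^'d \<Rightarrow> complex"
    and psi :: "real \<Rightarrow> real^'d \<Rightarrow> complex^'d"
  assumes markov: "transition_function I p"
    and affine: "affine_with I p psi0 psi"
    and ode_psi: "\<And>v t. t \<ge> 0 \<Longrightarrow>
        ((\<lambda>s. psi s v) has_vector_derivative (\<chi> k. R (Some k) (psi t v))) (at t within {0..})"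
    and init_psi: "\<And>v. psi 0 v = (\<chi> k. \<i> * of_real (v $ k))"
    and ode_psi0: "\<And>v t. t \<ge> 0 \<Longrightarrow>
        ((\<lambda>s. psi0 s v) has_vector_derivative R None (psi t v)) (at t within {0..})"
    and init_psi0: "\<And>v. psi0 0 v = 0"
begin

text \<open>Defined by the exponential side of the affine property, so that time derivatives come
  from the Riccati equations; \<open>Phi_eq\<close> identifies it with the Fourier transform of the
  kernel at v.\<close>

definition Phi :: "real \<Rightarrow> real^'d \<Rightarrow> real^'d \<Rightarrow> complex" where
  "Phi t v x = exp (psi0 t v + (\<Sum>k\<in>UNIV. psi t v $ k * of_real (x $ k)))"

definition laplace :: "real \<Rightarrow> real^'d \<Rightarrow> real^'d \<Rightarrow> real" where
  "laplace t u x = (\<integral>\<xi>. exp (u \<bullet> \<xi>) \<partial>p t x)"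

lemma sets_p [simp]: "t \<ge> 0 \<Longrightarrow> x \<in> stateD I \<Longrightarrow> sets (p t x) = sets borel"
  and subprob_p: "t \<ge> 0 \<Longrightarrow> x \<in> stateD I \<Longrightarrow> subprob_space (p t x)"
  using markov by (auto simp: transition_function_def)

lemma space_p [simp]: "t \<ge> 0 \<Longrightarrow> x \<in> stateD I \<Longrightarrow> space (p t x) = UNIV"
  using sets_eq_imp_space_eq[OF sets_p] by simp

lemma finite_p: "t \<ge> 0 \<Longrightarrow> x \<in> stateD I \<Longrightarrow> finite_measure (p t x)"
  using subprob_p subprob_space_def by blast

lemma measurable_p [simp]: "t \<ge> 0 \<Longrightarrow> x \<in> stateD I \<Longrightarrow> measurable (p t x) N = measurable borel N"
  by (rule measurable_cong_sets) auto

lemma AE_p: "t \<ge> 0 \<Longrightarrow> x \<in> stateD I \<Longrightarrow> AE \<xi> in p t x. \<xi> \<in> stateD I"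
  by (rule AE_I[where N="UNIV - stateD I"]) (use markov in \<open>auto simp: transition_function_def\<close>)

lemma Phi_eq:
  assumes "t \<ge> 0" "x \<in> stateD I"
  shows "(\<integral>\<xi>. exp (\<i> * of_real (v \<bullet> \<xi>)) \<partial>p t x) = Phi t v x"
proof -
  have lin: "(\<Sum>k\<in>UNIV. (\<i> * of_real (v $ k)) * of_real (\<xi> $ k)) = \<i> * complex_of_real (v \<bullet> \<xi>)" for \<xi>
    by (simp add: inner_eq_sum_nth sum_distrib_left mult_ac)
  have "(\<integral>\<xi>. exp (\<Sum>k\<in>UNIV. (\<i> * of_real (v $ k)) * of_real (\<xi> $ k)) \<partial>p t x) = Phi t v x"
    using affine assms unfolding affine_with_def Phi_def by blast
  then show ?thesis by (simp only: lin)
qed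

lemma norm_Phi_le_1:
  assumes "t \<ge> 0" "x \<in> stateD I"
  shows "norm (Phi t v x) \<le> 1"
proof -
  interpret subprob_space "p t x" by (rule subprob_p[OF assms])
  have "norm (\<integral>\<xi>. exp (\<i> * of_real (v \<bullet> \<xi>)) \<partial>p t x) \<le> (\<integral>\<xi>. norm (exp (\<i> * complex_of_real (v \<bullet> \<xi>))) \<partial>p t x)"
    by (rule integral_norm_bound)
  also have "\<dots> = measure (p t x) (space (p t x))" by simp
  also have "\<dots> \<le> 1" by (rule subprob_measure_le_1)
  finally show ?thesis using Phi_eq[OF assms] by simp
qed

text \<open>A characteristic function has norm at most 1. Along a coordinate half-axis its logarithm
  has affine real part, and an affine function bounded above on a half-line has nonpositive slope.
  Outside I both half-axes lie in the state space, so the slope is zero.\<close>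

lemma psi_in_left_cone:
  assumes t: "t \<ge> 0"
  shows "psi t v \<in> left_cone I"
proof -
  have le: "Re (psi0 t v) + Re (psi t v $ k) * r \<le> 0" if "0 \<le> r \<or> k \<notin> I" for k r
    using norm_Phi_le_1[OF t axis_in_stateD[OF that], of v] by (simp add: Phi_def sum_mult_axis)
  have nonpos: "c \<le> 0" if "\<And>r. 0 \<le> r \<Longrightarrow> b + c * r \<le> 0" for b c :: real
  proof (rule ccontr)
    assume "\<not> c \<le> 0"
    then have "c * ((\<bar>b\<bar> + 1) / c) = \<bar>b\<bar> + 1" "0 \<le> (\<bar>b\<bar> + 1) / c" by simp_all
    then have "b + (\<bar>b\<bar> + 1) \<le> 0" using that[of "(\<bar>b\<bar> + 1) / c"] by simp
    then show False by linarith
  qed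
  have "Re (psi t v $ k) \<le> 0" for k
    by (rule nonpos[of "Re (psi0 t v)"]) (use le in auto)
  moreover have "- Re (psi t v $ k) \<le> 0" if "k \<notin> I" for k
    by (rule nonpos[of "Re (psi0 t v)"]) (use le[of "- _" k] that in auto)
  ultimately show ?thesis by (auto simp: left_cone_def intro!: antisym)
qed

lemma Phi_zero_time: "Phi 0 v x = exp (\<i> * of_real (v \<bullet> x))"
  by (simp add: Phi_def init_psi init_psi0 inner_eq_sum_nth sum_distrib_left mult_ac)

lemma psi_nth_has_vector_derivative:
  assumes "t \<ge> 0"
  shows "((\<lambda>s. psi s v $ k) has_vector_derivative R (Some k) (psi t v)) (at t within {0..})"
  using bounded_linear.has_vector_derivative[OF bounded_linear_vec_nth ode_psi[OF assms, of v], of k] by simp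

lemma Phi_has_vector_derivative:
  assumes t: "t \<ge> 0"
  shows "((\<lambda>s. Phi s v x) has_vector_derivative
     ((R None (psi t v) + (\<Sum>k\<in>UNIV. R (Some k) (psi t v) * of_real (x $ k))) * Phi t v x)) (at t within {0..})"
proof -
  have "((\<lambda>s. psi0 s v + (\<Sum>k\<in>UNIV. psi s v $ k * of_real (x $ k))) has_vector_derivative
     (R None (psi t v) + (\<Sum>k\<in>UNIV. R (Some k) (psi t v) * of_real (x $ k)))) (at t within {0..})"
    by (intro has_vector_derivative_add ode_psi0[OF t] has_vector_derivative_sum
        has_vector_derivative_mult_left psi_nth_has_vector_derivative[OF t])
  from field_vector_diff_chain_within[OF this, of exp, OF has_field_derivative_at_within[OF DERIV_exp]]
  show ?thesis unfolding Phi_def comp_def by (simp add: mult.commute)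
qed

lemma Phi_continuous: "continuous_on {0..} (\<lambda>t. Phi t v x)"
  by (rule continuous_on_vector_derivative[OF Phi_has_vector_derivative]) auto

text \<open>This is the domination for the difference quotients at time zero: linear in h for all h,
  with a growth in w that the kernel can absorb.\<close>

lemma Phi_increment_bound:
  assumes x: "x \<in> stateD I"
  obtains C where "\<And>w h. 0 \<le> h \<Longrightarrow> norm (Phi h (w *\<^sub>R a) x - Phi 0 (w *\<^sub>R a) x) \<le> h * (C * (1 + w\<^sup>2))"
proof -
  obtain K where K: "0 < K" "\<And>j u. u \<in> left_cone I \<Longrightarrow> norm (R j u) \<le> K * (1 + (norm u)\<^sup>2)"
    using R_quadratic_growth by blast
  define X where "X = 1 + (\<Sum>k\<in>UNIV. \<bar>x $ k\<bar>)"
  have X: "1 \<le> X" unfolding X_def by (simp add: sum_nonneg)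
  define K' where "K' = real CARD('d) * K"
  have K': "0 \<le> K'" "K \<le> K'" using K(1) by (auto simp: K'_def)
  \<comment> \<open>The 5 comes from 1 + (2 M)^2 \<le> 5 M^2. It is doubled because for long times
    the increment is bounded by 2, and doubled again because M^2 is at most 2 (1 + (norm a)^2) (1 +
    w^2).\<close>
  define C where "C = 20 * K' * X * (1 + (norm a)\<^sup>2)"
  have "norm (Phi h (w *\<^sub>R a) x - Phi 0 (w *\<^sub>R a) x) \<le> h * (C * (1 + w\<^sup>2))" if h: "0 \<le> h" for w h
  proof -
    let ?v = "w *\<^sub>R a"
    define M where "M = 1 + norm ?v"
    have M1: "1 \<le> M" by (simp add: M_def)
    have "M\<^sup>2 \<le> 2 * (1 + (norm ?v)\<^sup>2)"
      using sum_squares_bound[of "norm ?v" 1] unfolding M_def power2_sum by simp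
    also have "\<dots> \<le> 2 * ((1 + (norm a)\<^sup>2) * (1 + w\<^sup>2))"
      by (auto simp: power_mult_distrib algebra_simps)
    finally have M2: "M\<^sup>2 \<le> 2 * ((1 + (norm a)\<^sup>2) * (1 + w\<^sup>2))" .
    have C: "10 * K' * X * M\<^sup>2 \<le> C * (1 + w\<^sup>2)"
    proof -
      have "10 * K' * X * M\<^sup>2 \<le> 10 * K' * X * (2 * ((1 + (norm a)\<^sup>2) * (1 + w\<^sup>2)))"
        using K' X by (intro mult_left_mono M2) auto
      also have "\<dots> = C * (1 + w\<^sup>2)" by (simp add: C_def algebra_simps)
      finally show ?thesis .
    qed
    have n0: "norm (psi 0 ?v) < M"
    proof -
      have "norm (psi 0 ?v) = norm ?v"
        unfolding init_psi norm_vec_def by (simp add: norm_mult abs_mult)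
      then show ?thesis by (simp add: M_def)
    qed
    have Rb: "norm (R j u) \<le> K * (5 * M\<^sup>2)" if "u \<in> left_cone I" "norm u \<le> 2 * M" for u j
    proof -
      have "(norm u)\<^sup>2 \<le> (2 * M)\<^sup>2" using that by (intro power_mono) auto
      moreover have "1 \<le> M\<^sup>2" using M1 by (simp add: one_le_power)
      ultimately have "1 + (norm u)\<^sup>2 \<le> 5 * M\<^sup>2" by (simp add: power_mult_distrib)
      then show ?thesis using K(2)[OF that(1), of j] mult_left_mono[of "1 + (norm u)\<^sup>2" "5 * M\<^sup>2" K] K(1) by linarith
    qed
    \<comment> \<open>R grows quadratically, so the Riccati equation controls psi only for times of order 1/M;
      for longer times the trivial bound by 2 suffices.\<close>
    show ?thesis
    proof (cases "h * (K' * (5 * M\<^sup>2)) \<le> M")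
      case True
      have psib: "norm (psi s ?v) \<le> 2 * M" if s: "0 \<le> s" "s \<le> h" for s
      proof (rule norm_le_until_from_derivative_bound[where B="K' * (5 * M\<^sup>2)" and f="\<lambda>s. psi s ?v" and f'="\<lambda>t. \<chi> k. R (Some k) (psi t ?v)"])
        fix t :: real assume t: "0 < t" "norm (psi t ?v) \<le> 2 * M"
        have "norm (\<chi> k. R (Some k) (psi t ?v)) \<le> (\<Sum>k\<in>UNIV. norm (R (Some k) (psi t ?v)))"
          unfolding norm_vec_def by (rule order_trans[OF L2_set_le_sum]) auto
        also have "\<dots> \<le> (\<Sum>k\<in>(UNIV :: 'd set). K * (5 * M\<^sup>2))"
          by (intro sum_mono Rb psi_in_left_cone t) (use t in auto)
        also have "\<dots> = K' * (5 * M\<^sup>2)" by (simp add: K'_def)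
        finally show "norm (\<chi> k. R (Some k) (psi t ?v)) \<le> K' * (5 * M\<^sup>2)" .
      qed (use ode_psi n0 K' True s in auto)
      show ?thesis
      proof (cases "h = 0")
        case False
        then have h0: "0 < h" using h by simp
        let ?f' = "\<lambda>t. (R None (psi t ?v) + (\<Sum>k\<in>UNIV. R (Some k) (psi t ?v) * of_real (x $ k))) * Phi t ?v x"
        have "\<exists>r\<in>{0<..<h}. norm (Phi h ?v x - Phi 0 ?v x) \<le> norm ((h - 0) *\<^sub>R ?f' r)"
        proof (rule mvt_general[OF h0])
          show "continuous_on {0..h} (\<lambda>t. Phi t ?v x)" by (rule continuous_on_subset[OF Phi_continuous]) auto
          fix r assume "0 < r" "r < h"
          then show "((\<lambda>t. Phi t ?v x) has_derivative (\<lambda>y. y *\<^sub>R ?f' r)) (at r)"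
            using Phi_has_vector_derivative[of r ?v x] at_within_interior[of r "{0..}"]
            by (simp add: has_vector_derivative_def)
        qed
        then obtain r where r: "0 < r" "r < h" "norm (Phi h ?v x - Phi 0 ?v x) \<le> h * norm (?f' r)" using h0 by auto
        have Rr: "norm (R j (psi r ?v)) \<le> K * (5 * M\<^sup>2)" for j
          using r by (intro Rb psi_in_left_cone psib) auto
        have "norm (\<Sum>k\<in>UNIV. R (Some k) (psi r ?v) * of_real (x $ k)) \<le> (\<Sum>k\<in>UNIV. K * (5 * M\<^sup>2) * \<bar>x $ k\<bar>)"
          by (intro sum_norm_le) (simp add: norm_mult mult_right_mono Rr)
        then have "norm (R None (psi r ?v) + (\<Sum>k\<in>UNIV. R (Some k) (psi r ?v) * of_real (x $ k))) \<le> K * (5 * M\<^sup>2) * X"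
          using norm_triangle_mono[OF Rr[of None]] by (simp add: X_def distrib_left sum_distrib_left)
        moreover have "norm (Phi r ?v x) \<le> 1" using r x by (intro norm_Phi_le_1) auto
        ultimately have "norm (?f' r) \<le> K * (5 * M\<^sup>2) * X * 1"
          unfolding norm_mult using K(1) X by (intro mult_mono) auto
        also have "\<dots> \<le> 10 * K' * X * M\<^sup>2"
        proof -
          have "K * (5 * M\<^sup>2 * X) \<le> K' * (10 * M\<^sup>2 * X)"
            using K' X K(1) by (intro mult_mono) auto
          then show ?thesis by (simp add: mult_ac)
        qed
        also note C
        finally show ?thesis using r(3) mult_left_mono[of "norm (?f' r)" "C * (1 + w\<^sup>2)" h] h by linarith
      qed simp
    next
      case False
      then have "M * 1 < M * (h * (K' * (5 * M)))" by (simp add: power2_eq_square mult_ac)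
      then have "1 < h * (K' * (5 * M))" using M1 by simp
      also have "\<dots> \<le> h * (K' * (5 * M\<^sup>2))"
        using M1 K' h by (intro mult_left_mono) (auto simp: power2_eq_square)
      finally have "2 \<le> h * (10 * K' * 1 * M\<^sup>2)" by (simp add: mult_ac)
      also have "\<dots> \<le> h * (10 * K' * X * M\<^sup>2)"
        using h K' X by (intro mult_left_mono mult_right_mono) auto
      also have "\<dots> \<le> h * (C * (1 + w\<^sup>2))" using C h by (intro mult_left_mono)
      finally have "2 \<le> h * (C * (1 + w\<^sup>2))" .
      moreover have "norm (Phi h ?v x - Phi 0 ?v x) \<le> 1 + 1"
        using h x by (intro order_trans[OF norm_triangle_ineq4] add_mono norm_Phi_le_1) auto
      ultimately show ?thesis by simp
    qed
  qed
  then show thesis by (rule that)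
qed

lemma Phi_ray_measurable:
  assumes "t \<ge> 0" "x \<in> stateD I"
  shows "(\<lambda>w. Phi t (w *\<^sub>R a) x) \<in> borel_measurable borel"
proof -
  interpret finite_measure "p t x" by (rule finite_p[OF assms])
  have [measurable_cong]: "sets (p t x) = sets borel" using assms by simp
  have "(\<lambda>w. \<integral>\<xi>. exp (\<i> * of_real (w * (a \<bullet> \<xi>))) \<partial>p t x) \<in> borel_measurable borel"
    by measurable
  then show ?thesis by (simp only: Phi_eq[OF assms, symmetric] inner_scaleR_left)
qed

section \<open>The Laplace transform in time\<close>

lemma laplace_by_Phi:
  assumes a: "- a \<in> neg_cone I" and t: "t \<ge> 0" and x: "x \<in> stateD I"
  shows "complex_of_real (laplace t (- a) x) = (\<integral>w. Phi t (w *\<^sub>R a) x * laplace_kernel w \<partial>lborel)"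
proof -
  have "AE \<xi> in p t x. 0 \<le> a \<bullet> \<xi>"
    using AE_p[OF t x] by eventually_elim (use inner_neg_cone_le_0[OF a] in fastforce)
  from laplace_by_characteristic[OF finite_p[OF t x] _ this]
  have "complex_of_real (\<integral>\<xi>. exp (- (a \<bullet> \<xi>)) \<partial>p t x)
     = (\<integral>w. (\<integral>\<xi>. exp (\<i> * of_real (w * (a \<bullet> \<xi>))) \<partial>p t x) * laplace_kernel w \<partial>lborel)"
    using t x by simp
  then show ?thesis by (simp only: Phi_eq[OF t x, symmetric] inner_scaleR_left laplace_def inner_minus_left)
qed

text \<open>The kernel transports continuity from \<open>Phi\<close>, with the bound 1 on
  \<open>Phi\<close> as domination. It makes the set in the continuous induction closed.\<close>

lemma laplace_continuous:
  assumes a: "- a \<in> neg_cone I" and x: "x \<in> stateD I"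
  shows "continuous_on {0..} (\<lambda>t. laplace t (- a) x)"
proof (rule continuous_on_sequentiallyI)
  fix s :: "nat \<Rightarrow> real" and t :: real assume "\<forall>n. s n \<in> {0..}" "t \<in> {0..}" "s \<longlonglongrightarrow> t"
  then have t: "0 \<le> t" and s: "\<And>n. 0 \<le> s n" and lim: "s \<longlonglongrightarrow> t" by auto
  have "(\<lambda>n. \<integral>w. Phi (s n) (w *\<^sub>R a) x * laplace_kernel w \<partial>lborel) \<longlonglongrightarrow> (\<integral>w. Phi t (w *\<^sub>R a) x * laplace_kernel w \<partial>lborel)"
  proof (rule integral_dominated_convergence)
    show "integrable lborel (\<lambda>w. norm (laplace_kernel w))"
      using integrable_norm[OF integrable_times_laplace_kernel[of "\<lambda>_. 1" 1]] by simp
    show "AE w in lborel. (\<lambda>n. Phi (s n) (w *\<^sub>R a) x * laplace_kernel w) \<longlonglongrightarrow> Phi t (w *\<^sub>R a) x * laplace_kernel w"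
    proof (intro AE_I2 tendsto_intros)
      fix w
      show "(\<lambda>n. Phi (s n) (w *\<^sub>R a) x) \<longlonglongrightarrow> Phi t (w *\<^sub>R a) x"
        using Phi_continuous[of "w *\<^sub>R a" x] t s lim unfolding continuous_on_sequentially comp_def by auto
    qed
    show "AE w in lborel. norm (Phi (s n) (w *\<^sub>R a) x * laplace_kernel w) \<le> norm (laplace_kernel w)" for n
      using norm_Phi_le_1[OF s x] by (auto simp: norm_mult intro!: mult_left_le_one_le)
  qed (use Phi_ray_measurable[OF t x] Phi_ray_measurable[OF s x] in measurable)
  then have "(\<lambda>n. complex_of_real (laplace (s n) (- a) x)) \<longlonglongrightarrow> of_real (laplace t (- a) x)"
    using laplace_by_Phi[OF a _ x] t s by simp
  then show "(\<lambda>n. laplace (s n) (- a) x) \<longlonglongrightarrow> laplace t (- a) x"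
    by (simp only: tendsto_of_real_iff)
qed

lemma laplace_zero_time: "x \<in> stateD I \<Longrightarrow> laplace 0 u x = exp (u \<bullet> x)"
  using markov by (simp add: laplace_def transition_function_def integral_return)

text \<open>At time zero \<open>psi\<close> equals i w a, so the derivative of \<open>Phi\<close>
  there is explicit in R on the imaginary ray. Dominated convergence differentiates under the
  kernel, and \<open>Rfun_kernel_integral\<close> evaluates the result at - a, component by
  component.\<close>

lemma laplace_right_derivative:
  assumes u: "u \<in> neg_cone I" and x: "x \<in> stateD I"
  shows "((\<lambda>t. laplace t u x) has_real_derivative
     (rR None u + (\<Sum>k\<in>UNIV. rR (Some k) u * x $ k)) * exp (u \<bullet> x)) (at 0 within {0..})"
proof -
  define a where "a = - u"
  have ua: "u = - a" and a: "- a \<in> neg_cone I" using u by (simp_all add: a_def)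
  have s0: "0 \<le> a \<bullet> x" using inner_neg_cone_le_0[OF u x] by (simp add: a_def)
  obtain C where C: "\<And>w h. 0 \<le> h \<Longrightarrow> norm (Phi h (w *\<^sub>R a) x - Phi 0 (w *\<^sub>R a) x) \<le> h * (C * (1 + w\<^sup>2))"
    using Phi_increment_bound[OF x] by blast
  let ?L = "(rR None u + (\<Sum>k\<in>UNIV. rR (Some k) u * x $ k)) * exp (u \<bullet> x)"
  let ?RR = "\<lambda>j w. R j (\<chi> l. \<i> * of_real ((w *\<^sub>R a) $ l))"
  let ?D = "\<lambda>w. (?RR None w + (\<Sum>k\<in>UNIV. ?RR (Some k) w * of_real (x $ k))) * exp (\<i> * of_real (w * (a \<bullet> x)))"
  let ?I = "\<lambda>j w. ?RR j w * exp (\<i> * of_real (w * (a \<bullet> x))) * laplace_kernel w"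
  have D_eq: "?D w * laplace_kernel w = ?I None w + (\<Sum>k\<in>UNIV. ?I (Some k) w * of_real (x $ k))" for w
    by (simp only: distrib_right sum_distrib_right) (simp only: mult_ac)
  have D_int: "integrable lborel (\<lambda>w. ?D w * laplace_kernel w)"
    unfolding D_eq by (intro Bochner_Integration.integrable_add Bochner_Integration.integrable_sum integrable_mult_left Rfun_kernel_integral(1)[OF s0 a])
  have "(\<integral>w. ?D w * laplace_kernel w \<partial>lborel) = (\<integral>w. ?I None w \<partial>lborel) + (\<Sum>k\<in>UNIV. (\<integral>w. ?I (Some k) w \<partial>lborel) * of_real (x $ k))"
  proof -
    have "(\<integral>w. ?D w * laplace_kernel w \<partial>lborel)
       = (\<integral>w. ?I None w \<partial>lborel) + (\<integral>w. (\<Sum>k\<in>UNIV. ?I (Some k) w * of_real (x $ k)) \<partial>lborel)"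
      unfolding D_eq
      by (intro Bochner_Integration.integral_add Bochner_Integration.integrable_sum integrable_mult_left Rfun_kernel_integral(1)[OF s0 a])
    also have "(\<integral>w. (\<Sum>k\<in>UNIV. ?I (Some k) w * of_real (x $ k)) \<partial>lborel)
       = (\<Sum>k\<in>UNIV. (\<integral>w. ?I (Some k) w * of_real (x $ k) \<partial>lborel))"
      by (intro Bochner_Integration.integral_sum integrable_mult_left Rfun_kernel_integral(1)[OF s0 a])
    finally show ?thesis by (simp only: integral_mult_left_zero)
  qed
  also have "\<dots> = of_real ?L"
    unfolding Rfun_kernel_integral(2)[OF s0 a] ua
    by (simp add: distrib_right sum_distrib_right) (simp add: mult_ac)
  finally have D_val: "(\<integral>w. ?D w * laplace_kernel w \<partial>lborel) = of_real ?L" .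
  show ?thesis
    unfolding has_field_derivative_iff tendsto_at_iff_sequentially
  proof (intro allI impI)
    fix X :: "nat \<Rightarrow> real" assume "\<forall>i. X i \<in> {0..} - {0}" and lim: "X \<longlonglongrightarrow> 0"
    then have Xp: "0 < X n" for n by (metis DiffE atLeast_iff insertCI order_le_less)
    then have X0: "0 \<le> X n" for n by (simp add: less_imp_le)
    let ?q = "\<lambda>n w. (Phi (X n) (w *\<^sub>R a) x - Phi 0 (w *\<^sub>R a) x) /\<^sub>R X n"
    have Phi_int: "integrable lborel (\<lambda>w. Phi t (w *\<^sub>R a) x * laplace_kernel w)" if "0 \<le> t" for t
    proof (rule integrable_times_laplace_kernel[where C=1])
      show "norm (Phi t (w *\<^sub>R a) x) \<le> 1 * (1 + w\<^sup>2)" for w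
        using norm_Phi_le_1[OF that x, of "w *\<^sub>R a"] by (smt (verit) zero_le_power2)
    qed (rule Phi_ray_measurable[OF that x])
    have "(\<lambda>n. \<integral>w. ?q n w * laplace_kernel w \<partial>lborel) \<longlonglongrightarrow> (\<integral>w. ?D w * laplace_kernel w \<partial>lborel)"
    proof (rule integral_dominated_convergence)
      show "integrable lborel (\<lambda>w. C * ((1 + w\<^sup>2) * norm (laplace_kernel w)))"
        by (intro integrable_mult_right integrable_laplace_kernel_bound)
      show "AE w in lborel. (\<lambda>n. ?q n w * laplace_kernel w) \<longlonglongrightarrow> ?D w * laplace_kernel w"
      proof (intro AE_I2 tendsto_intros)
        fix w
        have "((\<lambda>s. Phi s (w *\<^sub>R a) x) has_vector_derivative ?D w) (at 0 within {0..})"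
          using Phi_has_vector_derivative[of 0 "w *\<^sub>R a" x] by (simp add: init_psi Phi_zero_time)
        then show "(\<lambda>n. ?q n w) \<longlonglongrightarrow> ?D w"
          by (rule has_vector_derivative_right_sequence[OF _ Xp lim])
      qed
      show "AE w in lborel. norm (?q n w * laplace_kernel w) \<le> C * ((1 + w\<^sup>2) * norm (laplace_kernel w))" for n
      proof (rule AE_I2)
        fix w
        have "norm (?q n w) \<le> C * (1 + w\<^sup>2)"
        proof -
          have "norm (?q n w) = norm (Phi (X n) (w *\<^sub>R a) x - Phi 0 (w *\<^sub>R a) x) / X n"
            using Xp[of n] by (simp only: norm_scaleR) (simp add: divide_inverse mult.commute)
          also have "\<dots> \<le> C * (1 + w\<^sup>2)"
            using C[OF X0, of n w] Xp[of n] by (simp add: pos_divide_le_eq mult.commute)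
          finally show ?thesis .
        qed
        then show "norm (?q n w * laplace_kernel w) \<le> C * ((1 + w\<^sup>2) * norm (laplace_kernel w))"
          unfolding norm_mult mult.assoc[symmetric] by (intro mult_right_mono) auto
      qed
    qed (use D_int Phi_ray_measurable[OF X0 x] Phi_ray_measurable[OF order_refl x] in \<open>auto intro!: borel_measurable_times borel_measurable_diff borel_measurable_scaleR\<close>)
    moreover have "(\<integral>w. ?q n w * laplace_kernel w \<partial>lborel) = of_real ((laplace (X n) u x - laplace 0 u x) / X n)" for n
    proof -
      have "(\<lambda>w. ?q n w * laplace_kernel w)
          = (\<lambda>w. (Phi (X n) (w *\<^sub>R a) x * laplace_kernel w - Phi 0 (w *\<^sub>R a) x * laplace_kernel w) / of_real (X n))"
        by (rule ext) (simp add: scaleR_conv_of_real divide_inverse algebra_simps)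
      then show ?thesis
        using Phi_int X0
        by (simp add: Bochner_Integration.integral_diff laplace_by_Phi[OF a _ x, symmetric] ua)
    qed
    ultimately have "(\<lambda>n. complex_of_real ((laplace (X n) u x - laplace 0 u x) / X n)) \<longlonglongrightarrow> of_real ?L"
      unfolding D_val by simp
    then show "((\<lambda>y. (laplace y u x - laplace 0 u x) / (y - 0)) \<circ> X) \<longlonglongrightarrow> ?L"
      unfolding tendsto_of_real_iff by (simp add: comp_def)
  qed
qed

section \<open>Chapman-Kolmogorov, positivity and bounds\<close>

lemma nn_integral_Chapman_Kolmogorov:
  assumes s: "s \<ge> 0" and t: "t \<ge> 0" and x: "x \<in> stateD I" and f: "f \<in> borel_measurable borel"
  shows "(\<integral>\<^sup>+ \<xi>. f \<xi> \<partial>p (s + t) x) = (\<integral>\<^sup>+ y. \<integral>\<^sup>+ \<xi>. f \<xi> \<partial>p t y \<partial>p s x)"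
proof -
  \<comment> \<open>The map \<open>p t\<close> is a measurable kernel only on the state space.
    Restricting \<open>p s x\<close>, which charges nothing else, makes the composition a monadic
    bind.\<close>
  let ?N = "restrict_space (p s x) (stateD I)"
  have spN: "space ?N = stateD I" using s x by (simp add: space_restrict_space)
  have DN: "stateD I \<inter> space (p s x) \<in> sets (p s x)" using s x by simp
  have K: "p t \<in> measurable ?N (subprob_algebra borel)"
  proof (rule measurable_subprob_algebra)
    fix A :: "(real^'d) set" assume "A \<in> sets borel"
    then have "(\<lambda>y. emeasure (p t y) A) \<in> borel_measurable (restrict_space borel (stateD I))"
      using markov t by (simp add: transition_function_def)
    moreover have "sets ?N = sets (restrict_space borel (stateD I))"
      using s x by (intro sets_restrict_space_cong) auto
    ultimately show "(\<lambda>y. emeasure (p t y) A) \<in> borel_measurable ?N"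
      using measurable_cong_sets[of ?N "restrict_space borel (stateD I)" borel borel] by blast
  qed (use t subprob_p in \<open>auto simp: spN\<close>)
  have ne: "space ?N \<noteq> {}" unfolding spN using x by auto
  have restr: "(\<integral>\<^sup>+ y. F y \<partial>?N) = (\<integral>\<^sup>+ y. F y \<partial>p s x)" for F
    unfolding nn_integral_restrict_space[OF DN]
    by (rule nn_integral_cong_AE) (use AE_p[OF s x] in \<open>eventually_elim, simp\<close>)
  have "p (s + t) x = ?N \<bind> p t"
  proof (rule measure_eqI)
    show "sets (p (s + t) x) = sets (?N \<bind> p t)"
      using s t x sets_bind[OF _ ne, of "p t" borel] by (simp add: spN)
    fix A assume "A \<in> sets (p (s + t) x)"
    then have A: "A \<in> sets borel" using s t x by simp
    have "emeasure (p (s + t) x) A = (\<integral>\<^sup>+ y. emeasure (p t y) A \<partial>p s x)"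
      using markov s t x A by (simp add: transition_function_def)
    then show "emeasure (p (s + t) x) A = emeasure (?N \<bind> p t) A"
      by (simp add: emeasure_bind[OF ne K A] restr)
  qed
  then show ?thesis by (simp add: nn_integral_bind[OF f K] restr)
qed

lemma exp_neg_cone_le_1:
  assumes "u \<in> neg_cone I" "t \<ge> 0" "x \<in> stateD I"
  shows "AE \<xi> in p t x. exp (u \<bullet> \<xi>) \<le> 1"
  using AE_p[OF assms(2,3)] by eventually_elim (use inner_neg_cone_le_0[OF assms(1)] in auto)

lemma integrable_exp_neg_cone:
  assumes "u \<in> neg_cone I" "t \<ge> 0" "x \<in> stateD I"
  shows "integrable (p t x) (\<lambda>\<xi>. exp (u \<bullet> \<xi>))"
proof -
  interpret finite_measure "p t x" by (rule finite_p[OF assms(2,3)])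
  show ?thesis
    by (rule integrable_const_bound[where B=1]) (use exp_neg_cone_le_1[OF assms] assms in auto)
qed

lemma nn_integral_exp_neg_cone:
  assumes "u \<in> neg_cone I" "t \<ge> 0" "x \<in> stateD I"
  shows "(\<integral>\<^sup>+ \<xi>. ennreal (exp (u \<bullet> \<xi>)) \<partial>p t x) = ennreal (laplace t u x)"
  unfolding laplace_def by (rule nn_integral_eq_integral[OF integrable_exp_neg_cone[OF assms]]) auto

lemma mass_eq_Phi:
  assumes "t \<ge> 0" "x \<in> stateD I"
  shows "complex_of_real (measure (p t x) UNIV) = Phi t 0 x"
  using Phi_eq[OF assms, of 0] assms by (simp add: scaleR_conv_of_real)

text \<open>The mass is an exponential by the affine property, so it cannot vanish. Positivity is
  what permits logarithms and quotients of Laplace transforms later.\<close>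

lemma mass_pos:
  assumes "t \<ge> 0" "x \<in> stateD I"
  shows "0 < measure (p t x) UNIV"
proof -
  have "measure (p t x) UNIV \<noteq> 0" using mass_eq_Phi[OF assms] by (auto simp: Phi_def)
  then show ?thesis by (simp add: zero_less_measure_iff)
qed

lemma laplace_pos:
  assumes u: "u \<in> neg_cone I" and t: "t \<ge> 0" and x: "x \<in> stateD I"
  shows "0 < laplace t u x"
proof (rule ccontr)
  assume "\<not> 0 < laplace t u x"
  moreover have "0 \<le> laplace t u x" unfolding laplace_def by simp
  ultimately have "(\<integral>\<xi>. exp (u \<bullet> \<xi>) \<partial>p t x) = 0" unfolding laplace_def by simp
  then have "AE \<xi> in p t x. exp (u \<bullet> \<xi>) = 0"
    using integral_nonneg_eq_0_iff_AE[OF integrable_exp_neg_cone[OF u t x]] by simp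
  then have "AE \<xi> in p t x. False" by simp
  then have "emeasure (p t x) UNIV = 0" using t x by (simp add: AE_iff_null null_sets_def)
  then show False using mass_pos[OF t x] by (simp add: measure_def)
qed

lemma laplace_le_1:
  assumes u: "u \<in> neg_cone I" and t: "t \<ge> 0" and x: "x \<in> stateD I"
  shows "laplace t u x \<le> 1"
proof -
  interpret subprob_space "p t x" by (rule subprob_p[OF t x])
  have "laplace t u x \<le> (\<integral>\<xi>. 1 \<partial>p t x)"
    unfolding laplace_def
    by (rule integral_mono_AE) (use integrable_exp_neg_cone[OF u t x] exp_neg_cone_le_1[OF u t x] in auto)
  also have "\<dots> \<le> 1" using subprob_measure_le_1[of UNIV] t x by simp
  finally show ?thesis .
qed

section \<open>Exponentially affine dependence on the starting point\<close>

text \<open>The identity Phi x * Phi y = Phi (x + y) * Phi 0 holds for each w, but integration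
  against the kernel does not respect products. A product of Laplace transforms is therefore read as
  one Laplace transform under the product measure, whose characteristic function is the product of
  the two.\<close>

lemma laplace_mult:
  assumes u: "u \<in> neg_cone I" and t: "t \<ge> 0" and x: "x \<in> stateD I" and y: "y \<in> stateD I"
  shows "laplace t u x * laplace t u y = laplace t u (x + y) * laplace t u 0"
proof -
  define a where "a = - u"
  have ua: "u = - a" by (simp add: a_def)
  have conv: "complex_of_real (laplace t u x * laplace t u y)
      = (\<integral>w. Phi t (w *\<^sub>R a) x * Phi t (w *\<^sub>R a) y * laplace_kernel w \<partial>lborel)"
    if x: "x \<in> stateD I" and y: "y \<in> stateD I" for x y
  proof -
    interpret X: finite_measure "p t x" by (rule finite_p[OF t x])
    interpret Y: finite_measure "p t y" by (rule finite_p[OF t y])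
    interpret XY: pair_sigma_finite "p t x" "p t y" ..
    let ?P = "p t x \<Otimes>\<^sub>M p t y"
    have [measurable_cong]: "sets (p t x) = sets borel" "sets (p t y) = sets borel" using t x y by auto
    have fin: "finite_measure ?P"
      by (rule finite_measure_pair_measure) unfold_locales
    have pos: "AE z in ?P. 0 \<le> a \<bullet> fst z + a \<bullet> snd z"
    proof -
      have "AE \<xi> in p t x. AE \<eta> in p t y. 0 \<le> a \<bullet> fst (\<xi>, \<eta>) + a \<bullet> snd (\<xi>, \<eta>)"
        using AE_p[OF t x]
      proof eventually_elim
        case (elim \<xi>)
        show ?case using AE_p[OF t y]
          by eventually_elim (use elim inner_neg_cone_le_0[OF u] in \<open>fastforce simp: ua intro!: add_nonneg_nonneg\<close>)
      qed
      then show ?thesis by (intro XY.AE_pair_measure) auto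
    qed
    have "complex_of_real (\<integral>z. exp (- (a \<bullet> fst z + a \<bullet> snd z)) \<partial>?P)
      = (\<integral>w. (\<integral>z. exp (\<i> * of_real (w * (a \<bullet> fst z + a \<bullet> snd z))) \<partial>?P) * laplace_kernel w \<partial>lborel)"
      by (rule laplace_by_characteristic[OF fin _ pos]) measurable
    also have "(\<integral>z. exp (- (a \<bullet> fst z + a \<bullet> snd z)) \<partial>?P) = laplace t u x * laplace t u y"
      using integral_pair_measure_mult[OF X.finite_measure_axioms Y.finite_measure_axioms
          integrable_exp_neg_cone[OF u t x] integrable_exp_neg_cone[OF u t y]]
      by (simp add: laplace_def ua flip: exp_add)
    finally have eq: "complex_of_real (laplace t u x * laplace t u y)
      = (\<integral>w. (\<integral>z. exp (\<i> * of_real (w * (a \<bullet> fst z + a \<bullet> snd z))) \<partial>?P) * laplace_kernel w \<partial>lborel)" .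
    have "(\<integral>z. exp (\<i> * of_real (w * (a \<bullet> fst z + a \<bullet> snd z))) \<partial>?P) = Phi t (w *\<^sub>R a) x * Phi t (w *\<^sub>R a) y" for w
    proof -
      have int: "integrable (p t z) (\<lambda>\<xi>. exp (\<i> * complex_of_real ((w *\<^sub>R a) \<bullet> \<xi>)))" if z: "z \<in> stateD I" for z
      proof -
        interpret finite_measure "p t z" by (rule finite_p[OF t z])
        show ?thesis by (rule integrable_const_bound[where B=1]) (use t z in auto)
      qed
      have "(\<integral>z. exp (\<i> * complex_of_real ((w *\<^sub>R a) \<bullet> fst z)) * exp (\<i> * complex_of_real ((w *\<^sub>R a) \<bullet> snd z)) \<partial>?P)
         = Phi t (w *\<^sub>R a) x * Phi t (w *\<^sub>R a) y"
        using integral_pair_measure_mult[OF X.finite_measure_axioms Y.finite_measure_axioms int[OF x] int[OF y]]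
        by (simp only: Phi_eq[OF t x] Phi_eq[OF t y])
      moreover have "exp (\<i> * complex_of_real ((w *\<^sub>R a) \<bullet> fst z)) * exp (\<i> * complex_of_real ((w *\<^sub>R a) \<bullet> snd z))
         = exp (\<i> * of_real (w * (a \<bullet> fst z + a \<bullet> snd z)))" for z :: "(real^'d) \<times> (real^'d)"
        by (simp add: algebra_simps flip: exp_add)
      ultimately show ?thesis by (simp only:)
    qed
    then show ?thesis unfolding eq by (simp only:)
  qed
  have "Phi t v x * Phi t v y = Phi t v (x + y) * Phi t v 0" for v
    unfolding Phi_def exp_add[symmetric] by (simp add: sum.distrib algebra_simps)
  then have "complex_of_real (laplace t u x * laplace t u y) = complex_of_real (laplace t u (x + y) * laplace t u 0)"
    unfolding conv[OF x y] conv[OF stateD_add[OF x y] zero_in_stateD] by simp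
  then show ?thesis using of_real_eq_iff by blast
qed

text \<open>After normalisation by the value at 0, the transform is multiplicative, positive and
  bounded on the state space, hence exponential along every coordinate half-axis. Adding up the axes
  gives the formula.\<close>

lemma laplace_exp_affine:
  assumes u: "u \<in> neg_cone I" and t: "t \<ge> 0" and x: "x \<in> stateD I"
  shows "laplace t u x = laplace t u 0 * exp (\<Sum>k\<in>I. ln (laplace t u (axis k 1) / laplace t u 0) * x $ k)"
proof -
  let ?l = "\<lambda>x. laplace t u x / laplace t u 0"
  have p0: "0 < laplace t u 0" by (rule laplace_pos[OF u t]) simp
  have lpos: "0 < ?l x" if "x \<in> stateD I" for x using laplace_pos[OF u t that] p0 by simp
  have lle: "?l x \<le> 1 / laplace t u 0" if "x \<in> stateD I" for x
    using laplace_le_1[OF u t that] p0 by (simp add: divide_right_mono)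
  have lmult: "?l (x + y) = ?l x * ?l y" if "x \<in> stateD I" "y \<in> stateD I" for x y
    using laplace_mult[OF u t that] p0 by (simp add: field_simps)
  have lexp: "\<exists>b\<le>0. \<forall>r\<ge>0. ?l (axis k (\<sigma> * r)) = exp (b * r)" if "\<sigma> = 1 \<or> (\<sigma> = -1 \<and> k \<notin> I)" for k \<sigma>
  proof -
    have D: "axis k (\<sigma> * r) \<in> stateD I" if "0 \<le> r" for r
      using that \<open>\<sigma> = 1 \<or> (\<sigma> = -1 \<and> k \<notin> I)\<close> by (intro axis_in_stateD) auto
    obtain b where "b \<le> 0" "\<And>r. 0 \<le> r \<Longrightarrow> ?l (axis k (\<sigma> * r)) = exp (b * r)"
    proof (rule bounded_multiplicative_imp_exp[of "\<lambda>r. ?l (axis k (\<sigma> * r))" "1 / laplace t u 0"])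
      fix r s :: real assume rs: "0 \<le> r" "0 \<le> s"
      have "axis k (\<sigma> * (r + s)) = axis k (\<sigma> * r) + (axis k (\<sigma> * s) :: real^'d)"
        by (simp add: vec_eq_iff axis_def distrib_left)
      then show "?l (axis k (\<sigma> * (r + s))) = ?l (axis k (\<sigma> * r)) * ?l (axis k (\<sigma> * s))"
        using lmult[OF D[OF rs(1)] D[OF rs(2)]] by simp
    qed (use lpos[OF D] lle[OF D] in auto)
    then show ?thesis by blast
  qed
  define b where "b k = (if k \<in> I then ln (?l (axis k 1)) else 0)" for k
  have laxis: "?l (axis k (x $ k)) = exp (b k * x $ k)" for k
  proof (cases "k \<in> I")
    case True
    obtain c where c: "\<And>r. 0 \<le> r \<Longrightarrow> ?l (axis k r) = exp (c * r)" using lexp[of 1 k] by auto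
    have "b k = c" using c[of 1] True by (simp add: b_def)
    then show ?thesis using c[of "x $ k"] x True by (simp add: stateD_def)
  next
    case False
    obtain c where c: "c \<le> 0" "\<And>r. 0 \<le> r \<Longrightarrow> ?l (axis k r) = exp (c * r)" using lexp[of 1 k] by auto
    obtain d where d: "d \<le> 0" "\<And>r. 0 \<le> r \<Longrightarrow> ?l (axis k (- r)) = exp (d * r)" using lexp[of "-1" k] False by auto
    \<comment> \<open>Outside I both half-axes are available. Their exponents are nonpositive and
      add up to zero, so both vanish and the coordinate drops out.\<close>
    have "axis k 1 + axis k (- 1) = (0 :: real^'d)" by (simp add: vec_eq_iff axis_def)
    then have "?l 0 = ?l (axis k 1) * ?l (axis k (- 1))"
      using lmult[of "axis k 1" "axis k (- 1)"] False by (simp add: axis_in_stateD)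
    then have "exp (c + d) = 1" using c(2)[of 1] d(2)[of 1] p0 by (simp add: exp_add)
    then have "c + d = 0" by simp
    then have "c = 0" "d = 0" using c d by auto
    then have "?l (axis k r) = 1" for r
      using c(2)[of r] d(2)[of "- r"] by (cases "0 \<le> r") auto
    then show ?thesis using False by (simp add: b_def)
  qed
  have "?l (\<Sum>k\<in>S. axis k (x $ k)) = exp (\<Sum>k\<in>S. b k * x $ k) \<and> (\<Sum>k\<in>S. axis k (x $ k)) \<in> stateD I" for S
  proof (induction S rule: finite_induct[OF finite])
    case 1
    then show ?case using p0 by simp
  next
    case (2 k S)
    have "axis k (x $ k) \<in> stateD I" using x by (intro axis_in_stateD) (auto simp: stateD_def)
    with 2 show ?case by (simp add: lmult laxis stateD_add exp_add del: times_divide_eq_left times_divide_eq_right)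
  qed
  from this[of UNIV] have "?l (\<Sum>k\<in>UNIV. axis k (x $ k)) = exp (\<Sum>k\<in>UNIV. b k * x $ k)" by blast
  moreover have "(\<Sum>k\<in>UNIV. axis k (x $ k)) = x"
    by (simp add: vec_eq_iff axis_def if_distrib[of "\<lambda>f. f _"] sum.delta)
  moreover have "(\<Sum>k\<in>UNIV. b k * x $ k) = (\<Sum>k\<in>I. ln (?l (axis k 1)) * x $ k)"
    by (rule sum.mono_neutral_cong_right) (auto simp: b_def)
  ultimately show ?thesis using p0 by (simp add: field_simps)
qed

section \<open>Comparison with strict supersolutions\<close>

text \<open>The gain is that d does not depend on x. Exponential affineness reduces the claim to the
  value at 0 and one coefficient for each k in I, and each of these finitely many inequalities holds
  for short times because the derivatives at time zero differ strictly.\<close>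

lemma laplace_local_upper_bound:
  assumes u: "u \<in> neg_cone I" and c: "0 < c" and \<delta>: "0 < \<delta>" and z0: "z 0 = u"
    and z: "\<And>k. k \<in> I \<Longrightarrow> ((\<lambda>h. z h $ k) has_real_derivative z' k) (at 0 within {0..<\<delta>})"
    and zoff: "\<And>h k. k \<notin> I \<Longrightarrow> 0 < h \<Longrightarrow> h < \<delta> \<Longrightarrow> z h $ k = 0"
    and super: "\<And>k. k \<in> I \<Longrightarrow> rR (Some k) u < z' k"
  obtains d where "0 < d" "d \<le> \<delta>" "\<And>h x. 0 < h \<Longrightarrow> h < d \<Longrightarrow> x \<in> stateD I \<Longrightarrow> laplace h u x \<le> exp (c * h + z h \<bullet> x)"
proof -
  have axD: "axis k 1 \<in> stateD I" for k by (rule axis_in_stateD) simp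
  have lnder: "((\<lambda>h. ln (laplace h u x)) has_real_derivative (rR None u + (\<Sum>k\<in>UNIV. rR (Some k) u * x $ k))) (at 0 within {0..<\<delta>})"
    if x: "x \<in> stateD I" for x
  proof -
    have "((\<lambda>h. ln (laplace h u x)) has_real_derivative
       (1 / laplace 0 u x) * ((rR None u + (\<Sum>k\<in>UNIV. rR (Some k) u * x $ k)) * exp (u \<bullet> x))) (at 0 within {0..})"
      by (rule DERIV_chain2[OF _ laplace_right_derivative[OF u x]])
         (rule DERIV_ln_divide, rule laplace_pos[OF u _ x], simp)
    then have "((\<lambda>h. ln (laplace h u x)) has_real_derivative (rR None u + (\<Sum>k\<in>UNIV. rR (Some k) u * x $ k))) (at 0 within {0..})"
      by (simp add: laplace_zero_time[OF x])
    then show ?thesis by (rule has_field_derivative_subset) auto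
  qed
  have A: "((\<lambda>h. c * h - ln (laplace h u 0)) has_real_derivative c - rR None u) (at 0 within {0..<\<delta>})"
    using DERIV_diff[OF DERIV_cmult_Id[of c 0 "{0..<\<delta>}"] lnder[OF zero_in_stateD]] by simp
  \<comment> \<open>The slack c makes this inequality strict even where R None vanishes.\<close>
  have "0 < c - rR None u" using c rR_None_nonpos[OF u] by simp
  from has_real_derivative_pos_inc_right[OF A this] obtain d0 where d0: "0 < d0"
    "\<And>h. 0 < h \<Longrightarrow> h < \<delta> \<Longrightarrow> h < d0 \<Longrightarrow> ln (laplace h u 0) < c * h"
    using laplace_zero_time[of 0 u] by (auto simp: less_imp_le)
  have "\<exists>d>0. \<forall>h. 0 < h \<longrightarrow> h < \<delta> \<longrightarrow> h < d \<longrightarrow> ln (laplace h u (axis k 1) / laplace h u 0) \<le> z h $ k" if k: "k \<in> I" for k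
  proof -
    have sum: "(\<Sum>i\<in>UNIV. rR (Some i) u * axis k 1 $ i) = rR (Some k) u"
      by (simp add: axis_def if_distrib[of "\<lambda>y. _ * y"] sum.delta cong: if_cong)
    have B: "((\<lambda>h. z h $ k - (ln (laplace h u (axis k 1)) - ln (laplace h u 0))) has_real_derivative z' k - rR (Some k) u) (at 0 within {0..<\<delta>})"
      using DERIV_diff[OF z[OF k] DERIV_diff[OF lnder[OF axD, of k] lnder[OF zero_in_stateD]]]
      by (simp add: sum)
    have "0 < z' k - rR (Some k) u" using super[OF k] by simp
    from has_real_derivative_pos_inc_right[OF B this] obtain d where d: "0 < d"
      "\<And>h. 0 < h \<Longrightarrow> h < \<delta> \<Longrightarrow> h < d \<Longrightarrow> ln (laplace h u (axis k 1)) - ln (laplace h u 0) < z h $ k"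
      using laplace_zero_time[of 0 u] laplace_zero_time[OF axD, of u k] z0
      by (auto simp: less_imp_le inner_axis)
    have "ln (laplace h u (axis k 1) / laplace h u 0) = ln (laplace h u (axis k 1)) - ln (laplace h u 0)" if "0 < h" for h
      using laplace_pos[OF u _ axD, of h k] laplace_pos[OF u _ zero_in_stateD, of h] that by (simp add: ln_div)
    then show ?thesis using d by (auto intro!: exI[of _ d] less_imp_le)
  qed
  then obtain dk where dk: "\<And>k. k \<in> I \<Longrightarrow> 0 < dk k"
    "\<And>k h. k \<in> I \<Longrightarrow> 0 < h \<Longrightarrow> h < \<delta> \<Longrightarrow> h < dk k \<Longrightarrow> ln (laplace h u (axis k 1) / laplace h u 0) \<le> z h $ k"
    by metis
  define d where "d = Min (insert \<delta> (insert d0 (dk ` I)))"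
  have d: "0 < d" "d \<le> \<delta>" "d \<le> d0" "\<And>k. k \<in> I \<Longrightarrow> d \<le> dk k"
  proof -
    have fin: "finite (insert \<delta> (insert d0 (dk ` I)))" by simp
    show "0 < d" unfolding d_def using \<delta> d0 dk by (subst Min_gr_iff) auto
    show "d \<le> \<delta>" "d \<le> d0" "\<And>k. k \<in> I \<Longrightarrow> d \<le> dk k"
      unfolding d_def by (rule Min_le[OF fin]; simp)+
  qed
  show thesis
  proof (rule that[OF d(1,2)])
    fix h x assume h: "0 < h" "h < d" and x: "x \<in> stateD I"
    have "laplace h u x = exp (ln (laplace h u 0) + (\<Sum>k\<in>I. ln (laplace h u (axis k 1) / laplace h u 0) * x $ k))"
      using laplace_exp_affine[OF u _ x, of h] laplace_pos[OF u _ zero_in_stateD, of h] h by (simp add: exp_add)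
    also have "\<dots> \<le> exp (c * h + (\<Sum>k\<in>I. z h $ k * x $ k))"
      unfolding exp_le_cancel_iff
    proof (intro add_mono sum_mono mult_right_mono)
      show "ln (laplace h u 0) \<le> c * h" using d0(2)[of h] h d by simp
      fix k assume k: "k \<in> I"
      show "ln (laplace h u (axis k 1) / laplace h u 0) \<le> z h $ k" using dk(2)[OF k, of h] h d(2) d(4)[OF k] by simp
      show "0 \<le> x $ k" using x k by (simp add: stateD_def)
    qed
    also have "(\<Sum>k\<in>I. z h $ k * x $ k) = z h \<bullet> x"
      unfolding inner_eq_sum_nth by (rule sum.mono_neutral_left) (use zoff h d in auto)
    finally show "laplace h u x \<le> exp (c * h + z h \<bullet> x)" .
  qed
qed

lemma laplace_supersolution_bound:
  assumes c: "0 < c" and y: "\<And>t. 0 \<le> t \<Longrightarrow> t < T \<Longrightarrow> y t \<in> neg_cone I"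
    and der: "\<And>t k. 0 \<le> t \<Longrightarrow> t < T \<Longrightarrow> k \<in> I \<Longrightarrow> ((\<lambda>t. y t $ k) has_real_derivative y' t k) (at t within {0..<T})"
    and super: "\<And>t k. 0 \<le> t \<Longrightarrow> t < T \<Longrightarrow> k \<in> I \<Longrightarrow> rR (Some k) (y t) < y' t k"
    and \<tau>: "0 \<le> \<tau>" "\<tau> < T" and x: "x \<in> stateD I"
  shows "laplace \<tau> (y 0) x \<le> exp (c * \<tau> + y \<tau> \<bullet> x)"
proof -
  have y0: "y 0 \<in> neg_cone I" using y \<tau> by auto
  \<comment> \<open>The bound is required for all starting points at once, since the induction step
    integrates it over the position after a short time.\<close>
  define S where "S = {t \<in> {0..\<tau>}. \<forall>x\<in>stateD I. laplace t (y 0) x \<le> exp (c * t + y t \<bullet> x)}"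
  have cont: "continuous_on {0..\<tau>} y"
  proof (subst continuous_on_componentwise, rule ballI)
    fix i :: "real^'d" assume "i \<in> Basis"
    then obtain k where i: "i = axis k 1" by (auto simp: Basis_vec_def)
    show "continuous_on {0..\<tau>} (\<lambda>t. y t \<bullet> i)"
    proof (cases "k \<in> I")
      case True
      have "continuous_on {0..<T} (\<lambda>t. y t $ k)"
        by (rule DERIV_continuous_on) (use der True in auto)
      then have "continuous_on {0..\<tau>} (\<lambda>t. y t $ k)" by (rule continuous_on_subset) (use \<tau> in auto)
      then show ?thesis by (simp add: i inner_axis)
    next
      case False
      have "continuous_on {0..\<tau>} (\<lambda>t. 0 :: real)" by simp
      then show ?thesis
        by (rule continuous_on_eq) (use y \<tau> False in \<open>auto simp: i inner_axis neg_cone_def\<close>)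
    qed
  qed
  have cont_laplace: "continuous_on {0..\<tau>} (\<lambda>t. laplace t (y 0) x)" if "x \<in> stateD I" for x
    using laplace_continuous[of "- y 0" x] y0 that by (auto intro: continuous_on_subset)
  have "closed S"
  proof -
    have "closed ({0..\<tau>} \<inter> (\<lambda>t. laplace t (y 0) x - exp (c * t + y t \<bullet> x)) -` {..0})" if "x \<in> stateD I" for x
      by (intro continuous_closed_preimage continuous_intros cont_laplace[OF that] cont)
    then have "closed (\<Inter>x\<in>stateD I. {0..\<tau>} \<inter> (\<lambda>t. laplace t (y 0) x - exp (c * t + y t \<bullet> x)) -` {..0})"
      by (intro closed_INT) auto
    also have "\<dots> = S" unfolding S_def using x by auto
    finally show ?thesis .
  qed
  moreover have "0 \<in> S" using \<tau> by (auto simp: S_def laplace_zero_time)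
  moreover have bdd: "bdd_above S" by (rule bdd_aboveI[of _ \<tau>]) (auto simp: S_def)
  ultimately have sup: "Sup S \<in> S" by (intro closed_contains_Sup) auto
  define s where "s = Sup S"
  have s: "0 \<le> s" "s \<le> \<tau>" and bound: "\<And>x. x \<in> stateD I \<Longrightarrow> laplace s (y 0) x \<le> exp (c * s + y s \<bullet> x)"
    using sup by (auto simp: S_def s_def)
  have "s = \<tau>"
  proof (rule ccontr)
    assume "s \<noteq> \<tau>"
    then have "s < \<tau>" using s by simp
    have sT: "s < T" using s \<tau> by simp
    have ys: "y s \<in> neg_cone I" using y s sT by auto
    obtain d where d: "0 < d" "d \<le> T - s"
      "\<And>h x. 0 < h \<Longrightarrow> h < d \<Longrightarrow> x \<in> stateD I \<Longrightarrow> laplace h (y s) x \<le> exp (c * h + y (s + h) \<bullet> x)"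
    proof (rule laplace_local_upper_bound[OF ys c, of "T - s" "\<lambda>h. y (s + h)" "y' s"])
      fix k assume k: "k \<in> I"
      have "((\<lambda>t. y t $ k) has_real_derivative y' s k) (at (s + 0) within (+) s ` {0..<T - s})"
        unfolding add_0_right by (rule has_field_derivative_subset[OF der[OF s(1) sT k]]) (use s in auto)
      then have "((\<lambda>t. y t $ k) \<circ> (+) s has_real_derivative y' s k * 1) (at 0 within {0..<T - s})"
        by (rule DERIV_image_chain) (auto intro!: derivative_eq_intros)
      then show "((\<lambda>h. y (s + h) $ k) has_real_derivative y' s k) (at 0 within {0..<T - s})"
        by (simp add: comp_def)
      show "rR (Some k) (y s) < y' s k" by (rule super[OF s(1) sT k])
    next
      fix h k assume "k \<notin> I" "0 < h" "h < T - s"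
      then show "y (s + h) $ k = 0" using y[of "s + h"] s by (auto simp: neg_cone_def)
    qed (use sT in auto)
    define h where "h = min (d / 2) (\<tau> - s)"
    have h: "0 < h" "h < d" "s + h \<le> \<tau>" using d \<open>s < \<tau>\<close> by (auto simp: h_def)
    have "s + h \<in> S"
      unfolding S_def
    proof (intro CollectI conjI ballI)
      show "s + h \<in> {0..\<tau>}" using h s by auto
      fix x assume x: "x \<in> stateD I"
      have hs: "0 \<le> h" "0 \<le> h + s" using h s by auto
      \<comment> \<open>The short step is run first: the bound at time s applies to the position
        reached after h, and what is left is a short-time transform at \<open>y s\<close>, where the
        local estimate is available.\<close>
      have "ennreal (laplace (h + s) (y 0) x) = (\<integral>\<^sup>+ \<eta>. \<integral>\<^sup>+ \<xi>. ennreal (exp (y 0 \<bullet> \<xi>)) \<partial>p s \<eta> \<partial>p h x)"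
        unfolding nn_integral_exp_neg_cone[OF y0 hs(2) x, symmetric]
        by (rule nn_integral_Chapman_Kolmogorov) (use hs s x in auto)
      also have "\<dots> \<le> (\<integral>\<^sup>+ \<eta>. ennreal (exp (c * s)) * ennreal (exp (y s \<bullet> \<eta>)) \<partial>p h x)"
      proof (rule nn_integral_mono_AE)
        show "AE \<eta> in p h x. (\<integral>\<^sup>+ \<xi>. ennreal (exp (y 0 \<bullet> \<xi>)) \<partial>p s \<eta>) \<le> ennreal (exp (c * s)) * ennreal (exp (y s \<bullet> \<eta>))"
          using AE_p[OF hs(1) x]
        proof eventually_elim
          case (elim \<eta>)
          show ?case
            unfolding nn_integral_exp_neg_cone[OF y0 s(1) elim]
            using bound[OF elim] by (simp add: exp_add ennreal_leI flip: ennreal_mult')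
        qed
      qed
      also have "\<dots> = ennreal (exp (c * s)) * ennreal (laplace h (y s) x)"
        using hs x by (subst nn_integral_cmult) (auto simp: nn_integral_exp_neg_cone[OF ys hs(1) x])
      also have "\<dots> \<le> ennreal (exp (c * s)) * ennreal (exp (c * h + y (s + h) \<bullet> x))"
        by (intro mult_left_mono ennreal_leI d(3) h x) simp
      also have "\<dots> = ennreal (exp (c * (s + h) + y (s + h) \<bullet> x))"
        by (simp add: algebra_simps flip: ennreal_mult' exp_add)
      finally show "laplace (s + h) (y 0) x \<le> exp (c * (s + h) + y (s + h) \<bullet> x)"
        by (simp add: add.commute)
    qed
    then have "s + h \<le> s" unfolding s_def by (intro cSup_upper bdd)
    then show False using h by simp
  qed
  then show ?thesis using bound[OF x] by simp
qed

section \<open>Conservativeness\<close>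

lemma conservative_iff_mass:
  assumes "t \<ge> 0" "x \<in> stateD I"
  shows "emeasure (p t x) (stateD I) = 1 \<longleftrightarrow> Phi t 0 x = 1"
proof -
  interpret finite_measure "p t x" by (rule finite_p[OF assms])
  have "emeasure (p t x) (stateD I) = emeasure (p t x) UNIV"
    by (rule emeasure_eq_AE) (use AE_p[OF assms] assms in auto)
  also have "\<dots> = ennreal (measure (p t x) UNIV)" by (rule emeasure_eq_measure)
  finally have "emeasure (p t x) (stateD I) = 1 \<longleftrightarrow> measure (p t x) UNIV = 1"
    by (simp add: ennreal_eq_1)
  also have "\<dots> \<longleftrightarrow> Phi t 0 x = 1" unfolding mass_eq_Phi[OF assms, symmetric] by simp
  finally show ?thesis .
qed

text \<open>At v = 0 the exponential is a total mass, hence positive for every starting point. A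
  nonzero imaginary part c would make it negative at distance pi / \<bar>c\<bar> along the axis,
  where the phase has turned by half a circle.\<close>

lemma psi_zero_real:
  assumes t: "t \<ge> 0"
  shows "psi t 0 $ k = of_real (Re (psi t 0 $ k))"
proof -
  have "Im (psi t 0 $ k) = 0"
  proof (rule ccontr)
    define c where "c = Im (psi t 0 $ k)"
    assume "Im (psi t 0 $ k) \<noteq> 0"
    then have c: "c \<noteq> 0" by (simp add: c_def)
    define r where "r = pi / \<bar>c\<bar>"
    have r: "0 \<le> r" by (simp add: r_def)
    have D: "axis k r \<in> stateD I" by (rule axis_in_stateD) (use r in simp)
    define z where "z = psi t 0 $ k * of_real r"
    have "Phi t 0 (axis k r) = Phi t 0 0 * exp z"
      by (simp add: Phi_def sum_mult_axis exp_add z_def)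
    then have "complex_of_real (measure (p t (axis k r)) UNIV) = of_real (measure (p t 0) UNIV) * exp z"
      unfolding mass_eq_Phi[OF t D] mass_eq_Phi[OF t zero_in_stateD] .
    then have "Re (complex_of_real (measure (p t (axis k r)) UNIV)) = Re (of_real (measure (p t 0) UNIV) * exp z)"
      by (rule arg_cong)
    then have "measure (p t (axis k r)) UNIV = measure (p t 0) UNIV * Re (exp z)"
      by simp
    moreover have "Re (exp z) = - exp (Re z)"
    proof -
      have "Im z = c * (pi / \<bar>c\<bar>)" by (simp add: z_def c_def r_def)
      also have "\<dots> = (if 0 < c then pi else - pi)" using c by auto
      finally have "cos (Im z) = -1" by simp
      then show ?thesis by (simp add: Re_exp)
    qed
    ultimately have "measure (p t (axis k r)) UNIV = - (measure (p t 0) UNIV * exp (Re z))" by simp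
    moreover have "0 < measure (p t 0) UNIV * exp (Re z)" using mass_pos[OF t zero_in_stateD] by simp
    ultimately show False using mass_pos[OF t D] by linarith
  qed
  then show ?thesis by (simp add: complex_eq_iff)
qed

lemma conservative_of_unique:
  assumes R0: "R None 0 = 0"
    and uniq: "\<And>T g. 0 < T \<Longrightarrow> g 0 = (0::real^'d) \<Longrightarrow> \<forall>t\<in>{0..<T}. g t \<in> neg_cone I \<and>
        (\<forall>k\<in>I. ((\<lambda>s. complex_of_real (g s $ k)) has_vector_derivative
                        R (Some k) (\<chi> l. complex_of_real (g t $ l))) (at t within {0..<T}))
        \<Longrightarrow> \<forall>t\<in>{0..<T}. g t = 0"
    and t: "t \<ge> 0" and x: "x \<in> stateD I"
  shows "Phi t 0 x = 1"
proof -
  define g where "g s = (\<chi> k. Re (psi s 0 $ k))" for s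
  have gpsi: "(\<chi> l. complex_of_real (g s $ l)) = psi s 0" if "0 \<le> s" for s
    using psi_zero_real[OF that] by (simp add: g_def vec_eq_iff)
  have "\<forall>s\<in>{0..<t + 1}. g s = 0"
  proof (rule uniq)
    \<comment> \<open>The solution interval is half-open, so it has to reach beyond t to contain t
      itself.\<close>
    show "0 < t + 1" using t by simp
    show "g 0 = 0" by (simp add: g_def init_psi vec_eq_iff)
    show "\<forall>s\<in>{0..<t + 1}. g s \<in> neg_cone I \<and>
        (\<forall>k\<in>I. ((\<lambda>r. complex_of_real (g r $ k)) has_vector_derivative
                        R (Some k) (\<chi> l. complex_of_real (g s $ l))) (at s within {0..<t + 1}))"
    proof (intro ballI conjI)
      fix s assume s: "s \<in> {0..<t + 1}"
      show "g s \<in> neg_cone I"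
        using psi_in_left_cone[of s 0] s by (auto simp: g_def neg_cone_def left_cone_def)
      fix k
      have "((\<lambda>r. psi r 0 $ k) has_vector_derivative R (Some k) (psi s 0)) (at s within {0..<t + 1})"
        using s by (intro has_vector_derivative_within_subset[OF psi_nth_has_vector_derivative]) auto
      then have "((\<lambda>r. complex_of_real (g r $ k)) has_vector_derivative R (Some k) (psi s 0)) (at s within {0..<t + 1})"
        by (rule has_vector_derivative_transform[rotated 2]) (use s psi_zero_real in \<open>auto simp: g_def\<close>)
      then show "((\<lambda>r. complex_of_real (g r $ k)) has_vector_derivative
                        R (Some k) (\<chi> l. complex_of_real (g s $ l))) (at s within {0..<t + 1})"
        using s by (simp add: gpsi)
    qed
  qed
  then have psi0': "psi s 0 = 0" if "0 \<le> s" "s \<le> t" for s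
    using gpsi[of s] that by (simp add: vec_eq_iff)
  have "psi0 t 0 = psi0 0 0"
  proof (rule has_vector_derivative_zero_constant[of "{0..t}" "\<lambda>s. psi0 s 0", THEN exE])
    fix s assume s: "s \<in> {0..t}"
    then have "((\<lambda>s. psi0 s 0) has_vector_derivative R None (psi s 0)) (at s within {0..t})"
      by (intro has_vector_derivative_within_subset[OF ode_psi0]) auto
    then show "((\<lambda>s. psi0 s 0) has_vector_derivative 0) (at s within {0..t})"
      using s R0 by (simp add: psi0')
  qed (use t in auto)
  then show ?thesis using t by (simp add: Phi_def init_psi0 psi0')
qed

text \<open>Differentiating the constant 1 at time zero gives R None 0 + sum of R (Some k) 0 times
  x_k = 0 on the state space; the origin and the unit vectors separate the terms.\<close>

lemma conservative_imp:
  assumes cons: "\<And>t x. t \<ge> 0 \<Longrightarrow> x \<in> stateD I \<Longrightarrow> Phi t 0 x = 1"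
  shows "R None 0 = 0" and "R (Some k) 0 = 0"
proof -
  have psi00: "psi 0 0 = 0" by (simp add: init_psi vec_eq_iff)
  have zero: "D = 0" if "(f has_vector_derivative D) (at 0 within {0..})" "\<And>t. 0 \<le> t \<Longrightarrow> f t = c"
    for f :: "real \<Rightarrow> complex" and D c
  proof -
    have "((\<lambda>_. c) has_vector_derivative D) (at 0 within {0..})"
      by (rule has_vector_derivative_transform[OF _ _ that(1)]) (use that(2) in auto)
    moreover have "at 0 within {0::real..} \<noteq> bot" by (simp add: at_within_Ici_at_right)
    ultimately show ?thesis
      using vector_derivative_unique_within[of 0 "{0..}" "\<lambda>_. c" D 0] by simp
  qed
  have **: "(R None (psi 0 0) + (\<Sum>k\<in>UNIV. R (Some k) (psi 0 0) * of_real (x $ k))) * Phi 0 0 x = 0" if "x \<in> stateD I" for x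
    by (rule zero[OF Phi_has_vector_derivative[of 0 0 x], of 1]) (use cons that in auto)
  have *: "R None 0 + (\<Sum>k\<in>UNIV. R (Some k) 0 * of_real (x $ k)) = 0" if "x \<in> stateD I" for x
    using **[OF that] cons[OF order_refl that] by (simp only: psi00 mult_1_right)
  from *[of 0] show R0: "R None 0 = 0" by simp
  have sum: "(\<Sum>i\<in>UNIV. R (Some i) 0 * of_real (axis k 1 $ i)) = R (Some k) 0"
    using sum_mult_axis[of "\<chi> i. R (Some i) 0" k 1] by simp
  from *[of "axis k 1"] show "R (Some k) 0 = 0" unfolding sum by (simp add: R0 axis_in_stateD)
qed

text \<open>A solution g satisfies no strict inequality, so a barrier with strict margin is mixed in
  with weight \<epsilon>. It starts at \<epsilon> e, inside the negative cone, where Laplace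
  transforms still tend to the total mass as \<epsilon> vanishes.\<close>

lemma conservative_imp_unique:
  assumes cons: "\<And>t x. t \<ge> 0 \<Longrightarrow> x \<in> stateD I \<Longrightarrow> Phi t 0 x = 1"
    and g0: "g 0 = 0" and g: "\<And>t. 0 \<le> t \<Longrightarrow> t < T \<Longrightarrow> g t \<in> neg_cone I"
    and der: "\<And>t k. 0 \<le> t \<Longrightarrow> t < T \<Longrightarrow> k \<in> I \<Longrightarrow>
        ((\<lambda>s. g s $ k) has_real_derivative rR (Some k) (g t)) (at t within {0..<T})"
    and \<tau>: "0 \<le> \<tau>" "\<tau> < T"
  shows "g \<tau> = 0"
proof -
  define e :: "real^'d" where "e = (\<chi> k. if k \<in> I then -1 else 0)"
  have e: "e \<in> neg_cone I" by (simp add: e_def neg_cone_def)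
  have z: "(0::real^'d) \<in> neg_cone I" by (simp add: neg_cone_def)
  have R0: "rR (Some k) 0 = 0" for k
    using conservative_imp(2)[OF cons, of k] Rfun_of_real[of alpha beta gamma kappa "Some k" 0]
    by (simp add: zero_vec_def[symmetric])
  \<comment> \<open>Any C above all R (Some k) e works: the barrier component - exp (- C t) has
    derivative C E t, and this must exceed R at E t e. The leading 1 gives strictness.\<close>
  define C where "C = 1 + (\<Sum>k\<in>I. \<bar>rR (Some k) e\<bar>)"
  have C: "rR (Some k) e < C" if "k \<in> I" for k
    using member_le_sum[of k I "\<lambda>k. \<bar>rR (Some k) e\<bar>"] that by (simp add: C_def)
  define E where "E t = exp (- C * t)" for t
  have C0: "0 \<le> C" by (simp add: C_def sum_nonneg)
  have E: "0 < E t" "E t \<le> 1" if "0 \<le> t" for t using that C0 by (auto simp: E_def)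
  define y where "y \<epsilon> t = (1 - \<epsilon>) *\<^sub>R g t + \<epsilon> *\<^sub>R (E t *\<^sub>R e)" for \<epsilon> t
  have Ee: "E t *\<^sub>R e \<in> neg_cone I" if "0 \<le> t" for t
    using E[OF that] by (auto simp: e_def neg_cone_def)
  have yn: "y \<epsilon> t \<in> neg_cone I" if "0 < \<epsilon>" "\<epsilon> < 1" "0 \<le> t" "t < T" for \<epsilon> t
    unfolding y_def using convexD[OF convex_neg_cone g[OF that(3,4)] Ee[OF that(3)], of "1 - \<epsilon>" \<epsilon>] that by simp
  have bnd: "laplace \<tau> (\<epsilon> *\<^sub>R e) x \<le> exp (\<epsilon> * \<tau> + y \<epsilon> \<tau> \<bullet> x)" if \<epsilon>: "0 < \<epsilon>" "\<epsilon> < 1" and x: "x \<in> stateD I" for \<epsilon> x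
  proof -
    have "laplace \<tau> (y \<epsilon> 0) x \<le> exp (\<epsilon> * \<tau> + y \<epsilon> \<tau> \<bullet> x)"
    \<comment> \<open>The slack c is taken to be \<epsilon> as well, so one limit removes both
      perturbations.\<close>
    proof (rule laplace_supersolution_bound[of \<epsilon> T "y \<epsilon>" "\<lambda>t k. (1 - \<epsilon>) * rR (Some k) (g t) + \<epsilon> * (C * E t)"])
      fix t k assume t: "0 \<le> t" "t < T" and k: "k \<in> I"
      show "((\<lambda>t. y \<epsilon> t $ k) has_real_derivative (1 - \<epsilon>) * rR (Some k) (g t) + \<epsilon> * (C * E t)) (at t within {0..<T})"
        using k unfolding y_def E_def
        by (auto intro!: derivative_eq_intros der t simp: e_def)
      have "rR (Some k) (y \<epsilon> t) \<le> (1 - \<epsilon>) * rR (Some k) (g t) + \<epsilon> * rR (Some k) (E t *\<^sub>R e)"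
        unfolding y_def by (rule convex_onD[OF rR_convex]) (use \<epsilon> g[OF t] Ee[OF t(1)] in auto)
      \<comment> \<open>Since E t is at most 1 and R vanishes at 0, convexity between 0 and e makes
        R at E t e at most E t times R at e.\<close>
      also have "rR (Some k) (E t *\<^sub>R e) \<le> E t * rR (Some k) e"
        using convex_onD[OF rR_convex, of "E t" 0 e "Some k"] E[OF t(1)] z e R0 by simp
      also have "\<dots> < E t * C" using E[OF t(1)] C[OF k] by simp
      finally show "rR (Some k) (y \<epsilon> t) < (1 - \<epsilon>) * rR (Some k) (g t) + \<epsilon> * (C * E t)"
        using \<epsilon> by (simp add: mult.commute)
    qed (use yn[OF \<epsilon>] \<epsilon> \<tau> x in auto)
    then show ?thesis by (simp add: y_def g0 E_def)
  qed
  have "0 \<le> g \<tau> \<bullet> x" if x: "x \<in> stateD I" for x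
  proof -
    \<comment> \<open>The shift by 2 keeps every term strictly below 1, the first one
      included.\<close>
    define \<epsilon> where "\<epsilon> n = 1 / real (n + 2)" for n
    have \<epsilon>: "0 < \<epsilon> n" "\<epsilon> n < 1" for n by (auto simp: \<epsilon>_def)
    have lim\<epsilon>: "\<epsilon> \<longlonglongrightarrow> 0"
      unfolding \<epsilon>_def by real_asymp
    have "(\<lambda>n. laplace \<tau> (\<epsilon> n *\<^sub>R e) x) \<longlonglongrightarrow> (\<integral>\<xi>. 1 \<partial>p \<tau> x)"
      unfolding laplace_def
    proof (rule integral_dominated_convergence[where w="\<lambda>_. 1"])
      interpret finite_measure "p \<tau> x" by (rule finite_p[OF \<tau>(1) x])
      show "integrable (p \<tau> x) (\<lambda>_. 1::real)" by simp
      have "\<epsilon> n *\<^sub>R e \<in> neg_cone I" for n using \<epsilon>[of n] by (auto simp: e_def neg_cone_def)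
      from exp_neg_cone_le_1[OF this \<tau>(1) x]
      show "AE \<xi> in p \<tau> x. norm (exp ((\<epsilon> n *\<^sub>R e) \<bullet> \<xi>)) \<le> 1" for n by simp
      have "(\<lambda>n. exp ((\<epsilon> n *\<^sub>R e) \<bullet> \<xi>)) \<longlonglongrightarrow> exp ((0 *\<^sub>R e) \<bullet> \<xi>)" for \<xi>
        by (intro tendsto_intros lim\<epsilon>)
      then show "AE \<xi> in p \<tau> x. (\<lambda>n. exp ((\<epsilon> n *\<^sub>R e) \<bullet> \<xi>)) \<longlonglongrightarrow> 1" by simp
    qed (use \<tau> x in auto)
    moreover have "(\<integral>\<xi>. 1 \<partial>p \<tau> x) = (1::real)"
    proof -
      have "complex_of_real (measure (p \<tau> x) UNIV) = of_real 1"
        using mass_eq_Phi[OF \<tau>(1) x] cons[OF \<tau>(1) x] by simp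
      then have "measure (p \<tau> x) UNIV = 1" using of_real_eq_iff by blast
      then show ?thesis using \<tau> x by simp
    qed
    moreover have "(\<lambda>n. exp (\<epsilon> n * \<tau> + y (\<epsilon> n) \<tau> \<bullet> x)) \<longlonglongrightarrow> exp (0 * \<tau> + ((1 - 0) *\<^sub>R g \<tau> + 0 *\<^sub>R (E \<tau> *\<^sub>R e)) \<bullet> x)"
      unfolding y_def by (intro tendsto_intros lim\<epsilon>)
    ultimately have "1 \<le> exp (0 * \<tau> + ((1 - 0) *\<^sub>R g \<tau> + 0 *\<^sub>R (E \<tau> *\<^sub>R e)) \<bullet> x)"
      using bnd[OF \<epsilon> x] by (intro LIMSEQ_le) auto
    then show ?thesis by simp
  qed
  \<comment> \<open>Testing with unit vectors shows that all components are nonnegative; membership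
    in the negative cone gives the opposite sign.\<close>
  from this[OF axis_in_stateD[of 1]] have "0 \<le> g \<tau> $ k" for k by (simp add: inner_axis)
  then show ?thesis using g[OF \<tau>] by (auto simp: neg_cone_def vec_eq_iff intro: antisym)
qed

end

theorem theorem3p4:
  fixes I :: "'d::finite set"
    and p :: "real \<Rightarrow> real^'d \<Rightarrow> (real^'d) measure"
    and psi0 :: "real \<Rightarrow> real^'d \<Rightarrow> complex"
    and psi :: "real \<Rightarrow> real^'d \<Rightarrow> complex^'d"
    and alpha :: "'d option \<Rightarrow> real^'d^'d" and beta :: "'d option \<Rightarrow> real^'d"
    and gamma :: "'d option \<Rightarrow> real" and kappa :: "'d option \<Rightarrow> (real^'d) measure"
  assumes markov: "transition_function I p"
    and stoch_cont: "stoch_continuous I p"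
    and affine: "affine_with I p psi0 psi"
    and adm: "admissible I alpha beta gamma kappa"
    and ode_psi: "\<And>v t. t \<ge> 0 \<Longrightarrow>
        ((\<lambda>s. psi s v) has_vector_derivative
           (\<chi> k. Rfun alpha beta gamma kappa (Some k) (psi t v))) (at t within {0..})"
    and init_psi: "\<And>v. psi 0 v = (\<chi> k. \<i> * of_real (v $ k))"
    and ode_psi0: "\<And>v t. t \<ge> 0 \<Longrightarrow>
        ((\<lambda>s. psi0 s v) has_vector_derivative
           Rfun alpha beta gamma kappa None (psi t v)) (at t within {0..})"
    and init_psi0: "\<And>v. psi0 0 v = 0"
  shows "((\<forall>t\<ge>0. \<forall>x\<in>stateD I. emeasure (p t x) (stateD I) = 1) \<longleftrightarrow>
           (Rfun alpha beta gamma kappa None 0 = 0 \<and>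
            \<not> (\<exists>T>0. \<exists>g :: real \<Rightarrow> real^'d.
                 g 0 = 0 \<and>
                 (\<forall>t\<in>{0..<T}. (\<forall>k. k \<notin> I \<longrightarrow> g t $ k = 0) \<and> (\<forall>k\<in>I. g t $ k \<le> 0) \<and>
                    (\<forall>k\<in>I. ((\<lambda>s. complex_of_real (g s $ k)) has_vector_derivative
                        Rfun alpha beta gamma kappa (Some k) (\<chi> l. complex_of_real (g t $ l)))
                        (at t within {0..<T}))) \<and>
                 (\<exists>t\<in>{0..<T}. g t \<noteq> 0))))
         \<and> ((\<forall>t\<ge>0. \<forall>x\<in>stateD I. emeasure (p t x) (stateD I) = 1) \<longrightarrow>
              (\<forall>k. Rfun alpha beta gamma kappa (Some k) 0 = 0))"
proof -
  interpret affine_process I alpha beta gamma kappa p psi0 psi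
    by unfold_locales (fact adm markov affine ode_psi init_psi ode_psi0 init_psi0)+
  have cons: "(\<forall>t\<ge>0. \<forall>x\<in>stateD I. emeasure (p t x) (stateD I) = 1) \<longleftrightarrow> (\<forall>t\<ge>0. \<forall>x\<in>stateD I. Phi t 0 x = 1)"
    using conservative_iff_mass by auto
  have "g t = 0"
    if c: "\<forall>t\<ge>0. \<forall>x\<in>stateD I. Phi t 0 x = 1" and g0: "g 0 = 0" and t: "t \<in> {0..<T}" and
     g: "\<forall>t\<in>{0..<T}. (\<forall>k. k \<notin> I \<longrightarrow> g t $ k = 0) \<and> (\<forall>k\<in>I. g t $ k \<le> 0) \<and>
                    (\<forall>k\<in>I. ((\<lambda>s. complex_of_real (g s $ k)) has_vector_derivative
                        R (Some k) (\<chi> l. complex_of_real (g t $ l))) (at t within {0..<T}))"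
    for T t and g :: "real \<Rightarrow> real^'d"
  proof (rule conservative_imp_unique[of g T])
    fix s k assume s: "0 \<le> s" "s < T" and k: "k \<in> I"
    \<comment> \<open>At real arguments R is real, so the complex-valued equation is equivalent to a
      real one, obtained by taking real parts.\<close>
    have "((\<lambda>s. complex_of_real (g s $ k)) has_vector_derivative complex_of_real (rR (Some k) (g s))) (at s within {0..<T})"
      using g s k by (simp add: Rfun_of_real)
    from bounded_linear.has_vector_derivative[OF bounded_linear_Re this]
    show "((\<lambda>s. g s $ k) has_real_derivative rR (Some k) (g s)) (at s within {0..<T})"
      by (simp add: has_real_derivative_iff_has_vector_derivative)
  qed (use c g0 g t in \<open>auto simp: neg_cone_def\<close>)
  moreover have "\<forall>t\<ge>0. \<forall>x\<in>stateD I. Phi t 0 x = 1"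
    if "R None 0 = 0" "\<not> (\<exists>T>0. \<exists>g :: real \<Rightarrow> real^'d.
                 g 0 = 0 \<and>
                 (\<forall>t\<in>{0..<T}. (\<forall>k. k \<notin> I \<longrightarrow> g t $ k = 0) \<and> (\<forall>k\<in>I. g t $ k \<le> 0) \<and>
                    (\<forall>k\<in>I. ((\<lambda>s. complex_of_real (g s $ k)) has_vector_derivative
                        R (Some k) (\<chi> l. complex_of_real (g t $ l))) (at t within {0..<T}))) \<and>
                 (\<exists>t\<in>{0..<T}. g t \<noteq> 0))"
  proof (intro allI impI ballI, rule conservative_of_unique[OF that(1)])
    fix T and g :: "real \<Rightarrow> real^'d" assume "0 < T" "g 0 = 0" "\<forall>t\<in>{0..<T}. g t \<in> neg_cone I \<and>
        (\<forall>k\<in>I. ((\<lambda>s. complex_of_real (g s $ k)) has_vector_derivative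
                        R (Some k) (\<chi> l. complex_of_real (g t $ l))) (at t within {0..<T}))"
    then show "\<forall>t\<in>{0..<T}. g t = 0"
      using that(2) unfolding neg_cone_def mem_Collect_eq by blast
  qed
  ultimately show ?thesis
    unfolding cons using conservative_imp by (intro conjI iffI impI allI notI) (auto 0 3)
qed

end
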